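(* Let $X=L^2[0,1]$, let $V:X\to X$ be the Volterra integration operator $(Vx)(t)=\int_0^t x$, let $T=V^{-1}$, and let $D=\operatorname{dom}T\cap\operatorname{dom}T^*$. Then the following hold. (i) $T:\operatorname{dom}T\to X$ is given by $Tx=x'$ with $$\operatorname{dom}T=\{x\in L^2[0,1]: x\text{ is absolutely continuous},\ x(0)=0,\ x'\in L^2[0,1]\},$$ and $T^*:\operatorname{dom}T^*\to X$ is given by $T^*x=-x'$ with $$\operatorname{dom}T^*=\{x\in L^2[0,1]: x\text{ is absolutely continuous},\ x(1)=0,\ x'\in L^2[0,1]\}.$$ Both $T$ and $T^*$ are maximal monotone linear operators. (ii) $T$ is neither skew nor symmetric. (iii) The linear subspace $$D=\{x\in L^2[0,1]: x\text{ is absolutely continuous},\ x(0)=x(1)=0,\ x'\in L^2[0,1]\}$$ is dense in $X$. Moreover, $T$ and $T^*$ are skew on $D$.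
   Context: $L^2[0,1]$ is the real Hilbert space of (classes of) square-integrable real functions on $[0,1]$ with inner product $\langle x,y\rangle=\int_0^1xy$. An element is called absolutely continuous if it has an absolutely continuous representative on $[0,1]$; point values $x(0),x(1)$ refer to that representative, and $x'$ is its (a.e.) derivative. The operator $V$ is injective. For a set-valued operator $A:X\rightrightarrows X$, $\operatorname{gra}A=\{(x,x^* )\in X\times X\mid x^*\in Ax\}$, $\operatorname{dom}A=\{x\mid Ax\ne\varnothing\}$, and $A^{-1}$ is the operator with graph $\{(x^*,x)\mid(x,x^* )\in\operatorname{gra}A\}$. At most single-valued linear relations (operators whose graph is a linear subspace) are identified with linear operators on their domains. $A$ is monotone if $\langle x-y,x^*-y^*\rangle\ge0$ for all $(x,x^* ),(y,y^* )\in\operatorname{gra}A$, and maximal monotone if monotone with no proper monotone enlargement (in the sense of graph inclusion). For a linear relation $A$, the adjoint $A^*$ is defined by $\operatorname{gra}A^*=\{(x,x^* )\mid(x^*,-x)\in(\operatorname{gra}A)^\perp\}$; $A$ is skew if $\langle x,x^*\rangle=0$ for all $(x,x^* )\in\operatorname{gra}A$, and symmetric if $\operatorname{gra}A\subseteq\operatorname{gra}A^*$. A linear operator $A$ is skew on a subspace $D\subseteq\operatorname{dom}A$ if $\langle Ax,x\rangle=0$ for all $x\in D$. *)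

theory Defs
  imports "HOL-Analysis.Analysis"
begin

section \<open>The real Hilbert space L2[0,1]\<close>

abbreviation lebesgue01 :: "real measure"
  where "lebesgue01 \<equiv> lebesgue_on {0..1}"

definition square_integrable01 :: "(real \<Rightarrow> real) \<Rightarrow> bool" where
  "square_integrable01 f \<longleftrightarrow>
     f \<in> borel_measurable lebesgue01 \<and> integrable lebesgue01 (\<lambda>t. (f t)\<^sup>2)"

definition eq_L2 :: "(real \<Rightarrow> real) \<Rightarrow> (real \<Rightarrow> real) \<Rightarrow> bool" where
  "eq_L2 f g \<longleftrightarrow> square_integrable01 f \<and> square_integrable01 g \<and> (AE t in lebesgue01. f t = g t)"

lemma square_integrable01_mult:
  assumes "square_integrable01 f" "square_integrable01 g"
  shows "integrable lebesgue01 (\<lambda>t. f t * g t)"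
proof (rule Bochner_Integration.integrable_bound)
  show "integrable lebesgue01 (\<lambda>t. (f t)\<^sup>2 + (g t)\<^sup>2)"
    using assms by (auto simp: square_integrable01_def)
  show "(\<lambda>t. f t * g t) \<in> borel_measurable lebesgue01"
    using assms by (auto simp: square_integrable01_def)
  have "\<bar>a * b\<bar> \<le> a\<^sup>2 + b\<^sup>2" for a b :: real
  proof -
    have "2 * (\<bar>a\<bar> * \<bar>b\<bar>) \<le> a\<^sup>2 + b\<^sup>2"
      using sum_squares_bound[of "\<bar>a\<bar>" "\<bar>b\<bar>"] by (simp add: mult.assoc)
    moreover have "0 \<le> \<bar>a\<bar> * \<bar>b\<bar>" by simp
    ultimately show ?thesis unfolding abs_mult by linarith
  qed
  then show "AE t in lebesgue01. norm (f t * g t) \<le> norm ((f t)\<^sup>2 + (g t)\<^sup>2)"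
    by (intro AE_I2) simp
qed

lemma square_integrable01_add:
  assumes "square_integrable01 f" "square_integrable01 g"
  shows "square_integrable01 (\<lambda>t. f t + g t)"
  unfolding square_integrable01_def
proof
  show "(\<lambda>t. f t + g t) \<in> borel_measurable lebesgue01"
    using assms by (auto simp: square_integrable01_def)
  have "integrable lebesgue01 (\<lambda>t. (f t)\<^sup>2 + (g t)\<^sup>2 + 2 * (f t * g t))"
    using assms square_integrable01_mult[OF assms] by (auto simp: square_integrable01_def)
  then show "integrable lebesgue01 (\<lambda>t. (f t + g t)\<^sup>2)"
    by (simp add: power2_sum mult.assoc)
qed

lemma square_integrable01_scale:
  assumes "square_integrable01 f"
  shows "square_integrable01 (\<lambda>t. c * f t)"
  using assms by (auto simp: square_integrable01_def power_mult_distrib)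

lemma square_integrable01_uminus:
  assumes "square_integrable01 f"
  shows "square_integrable01 (\<lambda>t. - f t)"
  using assms by (auto simp: square_integrable01_def)

lemma square_integrable01_zero: "square_integrable01 (\<lambda>t. 0)"
  by (simp add: square_integrable01_def)

lemma square_integrable01_imp_integrable:
  assumes "square_integrable01 f"
  shows "integrable lebesgue01 f"
proof -
  interpret finite_measure lebesgue01
    by (rule finite_measure_lebesgue_on) simp
  show ?thesis
    using assms unfolding square_integrable01_def by (blast intro: square_integrable_imp_integrable)
qed

quotient_type L2 = "real \<Rightarrow> real" / partial: eq_L2
proof (rule part_equivpI)
  show "\<exists>f. eq_L2 f f"
    by (auto simp: eq_L2_def intro!: exI[of _ "\<lambda>t. 0"] square_integrable01_zero)
  show "symp eq_L2"
    by (rule sympI) (auto simp: eq_L2_def)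
  show "transp eq_L2"
  proof (rule transpI)
    fix f g h assume "eq_L2 f g" "eq_L2 g h"
    moreover from this have "AE t in lebesgue01. f t = g t" "AE t in lebesgue01. g t = h t"
      by (simp_all add: eq_L2_def)
    then have "AE t in lebesgue01. f t = h t"
      by eventually_elim simp
    ultimately show "eq_L2 f h"
      by (simp add: eq_L2_def)
  qed
qed

instantiation L2 :: real_inner
begin

lift_definition zero_L2 :: L2 is "\<lambda>t. 0"
  by (simp add: eq_L2_def square_integrable01_zero)

lift_definition plus_L2 :: "L2 \<Rightarrow> L2 \<Rightarrow> L2" is "\<lambda>f g t. f t + g t"
proof -
  fix f f' g g' assume a: "eq_L2 f f'" "eq_L2 g g'"
  then have "AE t in lebesgue01. f t = f' t" "AE t in lebesgue01. g t = g' t"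
    by (simp_all add: eq_L2_def)
  then have "AE t in lebesgue01. f t + g t = f' t + g' t"
    by eventually_elim simp
  then show "eq_L2 (\<lambda>t. f t + g t) (\<lambda>t. f' t + g' t)"
    using a by (simp add: eq_L2_def square_integrable01_add)
qed

lift_definition uminus_L2 :: "L2 \<Rightarrow> L2" is "\<lambda>f t. - f t"
proof -
  fix f g :: "real \<Rightarrow> real" assume a: "eq_L2 f g"
  then have "AE t in lebesgue01. f t = g t"
    by (simp add: eq_L2_def)
  then have "AE t in lebesgue01. - f t = - g t"
    by eventually_elim simp
  then show "eq_L2 (\<lambda>t. - f t) (\<lambda>t. - g t)"
    using a by (simp add: eq_L2_def square_integrable01_uminus)
qed

lift_definition scaleR_L2 :: "real \<Rightarrow> L2 \<Rightarrow> L2" is "\<lambda>c f t. c * f t"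
proof -
  fix f g :: "real \<Rightarrow> real" and c :: real assume a: "eq_L2 f g"
  then have "AE t in lebesgue01. f t = g t"
    by (simp add: eq_L2_def)
  then have "AE t in lebesgue01. c * f t = c * g t"
    by eventually_elim simp
  then show "eq_L2 (\<lambda>t. c * f t) (\<lambda>t. c * g t)"
    using a by (simp add: eq_L2_def square_integrable01_scale)
qed

lift_definition inner_L2 :: "L2 \<Rightarrow> L2 \<Rightarrow> real" is "\<lambda>f g. LINT t|lebesgue01. f t * g t"
proof -
  fix f f' g g' assume a: "eq_L2 f f'" "eq_L2 g g'"
  then have "AE t in lebesgue01. f t = f' t" "AE t in lebesgue01. g t = g' t"
    by (simp_all add: eq_L2_def)
  then have "AE t in lebesgue01. f t * g t = f' t * g' t"
    by eventually_elim simp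
  then show "(LINT t|lebesgue01. f t * g t) = (LINT t|lebesgue01. f' t * g' t)"
    using a by (intro integral_cong_AE) (auto simp: eq_L2_def square_integrable01_def)
qed

definition minus_L2 :: "L2 \<Rightarrow> L2 \<Rightarrow> L2" where "minus_L2 x y = x + (- y)"
definition norm_L2 :: "L2 \<Rightarrow> real" where "norm_L2 x = sqrt (inner x x)"
definition sgn_L2 :: "L2 \<Rightarrow> L2" where "sgn_L2 x = inverse (norm x) *\<^sub>R x"
definition dist_L2 :: "L2 \<Rightarrow> L2 \<Rightarrow> real" where "dist_L2 x y = norm (x - y)"
definition uniformity_L2 :: "(L2 \<times> L2) filter" where
  "uniformity_L2 = (INF e\<in>{0<..}. principal {(x, y). dist x y < e})"
definition open_L2 :: "L2 set \<Rightarrow> bool" where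
  "open_L2 U = (\<forall>x\<in>U. eventually (\<lambda>(x', y). x' = x \<longrightarrow> y \<in> U) uniformity)"

instance
proof
  fix x y z :: L2 and a b :: real
  show "x + y + z = x + (y + z)"
    by transfer (auto simp: eq_L2_def add.assoc intro!: square_integrable01_add)
  show "x + y = y + x"
    by transfer (auto simp: eq_L2_def add.commute intro!: square_integrable01_add)
  show "0 + x = x"
    by transfer (auto simp: eq_L2_def)
  show "- x + x = 0"
    by transfer (auto simp: eq_L2_def square_integrable01_zero)
  show "x - y = x + - y"
    by (simp add: minus_L2_def)
  show "a *\<^sub>R (x + y) = a *\<^sub>R x + a *\<^sub>R y"
    by transfer (auto simp: eq_L2_def distrib_left
        intro!: square_integrable01_add square_integrable01_scale)
  show "(a + b) *\<^sub>R x = a *\<^sub>R x + b *\<^sub>R x"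
    by transfer (auto simp: eq_L2_def distrib_right
        intro!: square_integrable01_add square_integrable01_scale)
  show "a *\<^sub>R b *\<^sub>R x = (a * b) *\<^sub>R x"
    by transfer (auto simp: eq_L2_def mult.assoc intro!: square_integrable01_scale)
  show "1 *\<^sub>R x = x"
    by transfer (auto simp: eq_L2_def)
  show "sgn x = inverse (norm x) *\<^sub>R x"
    by (simp add: sgn_L2_def)
  show "dist x y = norm (x - y)"
    by (simp add: dist_L2_def)
  show "uniformity = (INF e\<in>{0<..}. principal {(x, y). dist (x::L2) y < e})"
    by (simp add: uniformity_L2_def)
  show "open U = (\<forall>x\<in>U. eventually (\<lambda>(x', y). x' = x \<longrightarrow> y \<in> U) uniformity)" for U :: "L2 set"
    by (simp add: open_L2_def)
  show "inner x y = inner y x"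
    by transfer (simp add: mult.commute)
  show "inner (x + y) z = inner x z + inner y z"
    by transfer (auto simp: eq_L2_def distrib_right square_integrable01_mult)
  show "inner (a *\<^sub>R x) y = a * inner x y"
    by transfer (auto simp: mult.assoc)
  show "0 \<le> inner x x"
    by transfer simp
  show "inner x x = 0 \<longleftrightarrow> x = 0"
  proof (transfer)
    fix f :: "real \<Rightarrow> real"
    assume "eq_L2 f f"
    then have f: "square_integrable01 f" by (simp add: eq_L2_def)
    then have "(LINT t|lebesgue01. f t * f t) = 0 \<longleftrightarrow> (AE t in lebesgue01. f t * f t = 0)"
      by (intro integral_nonneg_eq_0_iff_AE square_integrable01_mult) auto
    then show "(LINT t|lebesgue01. f t * f t) = 0 \<longleftrightarrow> eq_L2 f (\<lambda>t. 0)"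
      using f by (simp add: eq_L2_def square_integrable01_zero)
  qed
  show "norm x = sqrt (inner x x)"
    by (simp add: norm_L2_def)
qed

end

section \<open>The Volterra operator\<close>

lift_definition volterra :: "L2 \<Rightarrow> L2" is "\<lambda>f t. LINT s|lebesgue_on {0..t}. f s"
proof -
  fix f g :: "real \<Rightarrow> real"
  assume fg: "eq_L2 f g"
  have sq: "square_integrable01 (\<lambda>t. LINT s|lebesgue_on {0..t}. h s)"
    if h: "square_integrable01 h" for h
  proof -
    have cont: "continuous_on {0..1} (\<lambda>t. LINT s|lebesgue_on {0..t}. h s)"
      by (intro indefinite_integral_continuous_real square_integrable01_imp_integrable h)
    then have cont2: "continuous_on {0..1} (\<lambda>t. (LINT s|lebesgue_on {0..t}. h s)\<^sup>2)"
      by (intro continuous_intros)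
    show ?thesis
      unfolding square_integrable01_def
      using continuous_imp_measurable_on_sets_lebesgue[OF cont]
        continuous_imp_integrable_real[OF cont2]
      by auto
  qed
  have "(LINT s|lebesgue_on {0..t}. f s) = (LINT s|lebesgue_on {0..t}. g s)"
    if t: "t \<in> {0..1}" for t
  proof (rule integral_cong_AE)
    have sub: "{0..t} \<subseteq> {0..1}" using t by auto
    have "AE s in lebesgue. s \<in> {0..1} \<longrightarrow> f s = g s"
      using fg by (simp add: eq_L2_def AE_restrict_space_iff)
    then have "AE s in lebesgue. s \<in> {0..t} \<longrightarrow> f s = g s"
      by (rule AE_mp) (use sub in auto)
    then show "AE s in lebesgue_on {0..t}. f s = g s"
      by (simp add: AE_restrict_space_iff)
    show "f \<in> borel_measurable (lebesgue_on {0..t})" "g \<in> borel_measurable (lebesgue_on {0..t})"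
      using fg sub
      by (auto simp: eq_L2_def square_integrable01_def intro: measurable_restrict_mono)
  qed
  then have "AE t in lebesgue01.
      (LINT s|lebesgue_on {0..t}. f s) = (LINT s|lebesgue_on {0..t}. g s)"
    by (intro AE_I2) (auto simp: space_restrict_space)
  then show "eq_L2 (\<lambda>t. LINT s|lebesgue_on {0..t}. f s) (\<lambda>t. LINT s|lebesgue_on {0..t}. g s)"
    using fg by (auto simp: eq_L2_def intro: sq)
qed

section \<open>Absolutely continuous elements\<close>

definition absolutely_continuous_on :: "real set \<Rightarrow> (real \<Rightarrow> real) \<Rightarrow> bool" where
  "absolutely_continuous_on S f \<longleftrightarrow>
     (\<forall>\<epsilon>>0. \<exists>\<delta>>0. \<forall>(n::nat) a b.
        (\<forall>i<n. a i \<le> b i \<and> {a i..b i} \<subseteq> S) \<and>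
        disjoint_family_on (\<lambda>i. {a i<..<b i}) {..<n} \<and>
        (\<Sum>i<n. b i - a i) < \<delta> \<longrightarrow>
        (\<Sum>i<n. \<bar>f (b i) - f (a i)\<bar>) < \<epsilon>)"

text \<open>\<^term>\<open>rep_L2 x\<close> is an arbitrary function in the class \<open>x\<close>, so only almost-everywhere
  statements about it are meaningful.\<close>

definition ac_representative :: "L2 \<Rightarrow> (real \<Rightarrow> real) \<Rightarrow> bool" where
  "ac_representative x f \<longleftrightarrow>
     absolutely_continuous_on {0..1} f \<and> (AE t in lebesgue01. rep_L2 x t = f t)"

text \<open>The class \<open>y\<close> is the almost-everywhere derivative of the function \<open>f\<close>. In particular
  \<open>f' \<in> L\<^sup>2[0,1]\<close> is expressed by the existence of such a \<open>y\<close>.\<close>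

definition has_L2_derivative :: "(real \<Rightarrow> real) \<Rightarrow> L2 \<Rightarrow> bool" where
  "has_L2_derivative f y \<longleftrightarrow>
     (AE t in lebesgue01. (f has_real_derivative rep_L2 y t) (at t within {0..1}))"

section \<open>Set-valued operators\<close>

definition gra :: "('a \<Rightarrow> 'a set) \<Rightarrow> ('a \<times> 'a) set" where
  "gra A = {(x, xs). xs \<in> A x}"

definition op_dom :: "('a \<Rightarrow> 'a set) \<Rightarrow> 'a set" where
  "op_dom A = {x. A x \<noteq> {}}"

definition op_inverse :: "('a \<Rightarrow> 'a set) \<Rightarrow> 'a \<Rightarrow> 'a set" where
  "op_inverse A = (\<lambda>xs. {x. (x, xs) \<in> gra A})"

definition linear_relation :: "('a::real_vector \<Rightarrow> 'a set) \<Rightarrow> bool" where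
  "linear_relation A \<longleftrightarrow> subspace (gra A)"

definition at_most_single_valued :: "('a \<Rightarrow> 'a set) \<Rightarrow> bool" where
  "at_most_single_valued A \<longleftrightarrow> (\<forall>x y z. y \<in> A x \<and> z \<in> A x \<longrightarrow> y = z)"

definition linear_operator :: "('a::real_vector \<Rightarrow> 'a set) \<Rightarrow> bool" where
  "linear_operator A \<longleftrightarrow> linear_relation A \<and> at_most_single_valued A"

definition monotone_op :: "('a::real_inner \<Rightarrow> 'a set) \<Rightarrow> bool" where
  "monotone_op A \<longleftrightarrow>
     (\<forall>(x, xs)\<in>gra A. \<forall>(y, ys)\<in>gra A. inner (x - y) (xs - ys) \<ge> 0)"

definition maximal_monotone :: "('a::real_inner \<Rightarrow> 'a set) \<Rightarrow> bool" where
  "maximal_monotone A \<longleftrightarrow>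
     monotone_op A \<and> \<not> (\<exists>B. monotone_op B \<and> gra A \<subset> gra B)"

definition op_adjoint :: "('a::real_inner \<Rightarrow> 'a set) \<Rightarrow> 'a \<Rightarrow> 'a set" where
  "op_adjoint A = (\<lambda>x. {xs. (xs, - x) \<in> (gra A)\<^sup>\<bottom>})"

definition skew_op :: "('a::real_inner \<Rightarrow> 'a set) \<Rightarrow> bool" where
  "skew_op A \<longleftrightarrow> (\<forall>(x, xs)\<in>gra A. inner x xs = 0)"

definition symmetric_op :: "('a::real_inner \<Rightarrow> 'a set) \<Rightarrow> bool" where
  "symmetric_op A \<longleftrightarrow> gra A \<subseteq> gra (op_adjoint A)"

text \<open>Used for linear operators \<open>A\<close>, so \<open>A x\<close> has exactly one element for \<open>x \<in> D\<close>.\<close>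

definition skew_op_on :: "'a::real_inner set \<Rightarrow> ('a \<Rightarrow> 'a set) \<Rightarrow> bool" where
  "skew_op_on D A \<longleftrightarrow> subspace D \<and> D \<subseteq> op_dom A \<and> (\<forall>x\<in>D. \<forall>y\<in>A x. inner y x = 0)"

end

theory Submission
  imports Defs
begin

text \<open>
  Everything rests on one description of the absolutely continuous elements whose derivative is
  square integrable: they are exactly the elements \<open>c 1 + V y\<close>, with \<open>1\<close> the constant function,
  the pair \<open>(c, y)\<close> is unique, and the absolutely continuous representative of \<open>c 1 + V y\<close> takes
  the value \<open>c\<close> at \<open>0\<close> and \<open>c + \<langle>1, y\<rangle>\<close> at \<open>1\<close> and has derivative \<open>y\<close>
  (\<open>ac_representative_const_add_volterra\<close>, \<open>ac_representative_imp_const_add_volterra\<close>,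
  \<open>const_add_volterra_eq_iff\<close>). This is Lebesgue's fundamental theorem of calculus in both
  directions. That an absolutely continuous function is the integral of its derivative has a short
  proof by gauge integration: tags in the exceptional null set are confined to an open set
  of small measure, where absolute continuity controls the increments
  (\<open>absolutely_continuous_has_integral_derivative\<close>). That an indefinite integral is differentiable
  almost everywhere follows from the convergence of one-sided averages, applied to the integrand
  and to its reflection (\<open>indefinite_integral_has_derivative_ae\<close>).

  Integrating the derivative of the product of two primitives gives
  \<open>\<langle>V x, y\<rangle> + \<langle>x, V y\<rangle> = \<langle>1, x\<rangle> \<langle>1, y\<rangle>\<close>. Hence \<open>V\<close> has the adjoint \<open>V* y = \<langle>1, y\<rangle> 1 - V y\<close>, and
  \<open>\<langle>V x, x\<rangle> = \<langle>1, x\<rangle>\<^sup>2 / 2\<close>, so \<open>V\<close> and \<open>V*\<close> are linear, everywhere defined, injective and monotone.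
  The inverse of such an operator is a maximal monotone linear operator
  (\<open>maximal_monotone_op_inverse\<close>, \<open>linear_operator_op_inverse\<close>), and \<open>T* = (V*)\<inverse>\<close> (\<open>op_adjoint_op_inverse\<close>). The domains are the
  ranges of \<open>V\<close> and \<open>V*\<close>, and the boundary conditions are read off from the description above.

  By uniqueness of the coefficients, \<open>V y = V* z\<close> holds only if \<open>\<langle>1, y\<rangle> = 0\<close> and \<open>z = - y\<close>. So
  \<open>D = {V y | \<langle>1, y\<rangle> = 0}\<close>, and \<open>\<langle>V y, y\<rangle> = 0\<close> there, which is skewness on \<open>D\<close>. The vector \<open>V 1\<close> shows
  that \<open>T\<close> itself is neither skew nor symmetric. Density of \<open>D\<close> is an
  approximation argument: the closure of \<open>D\<close> is stable under dominated limits (\<open>closure_dominated_limit\<close>), which lead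
  from polynomials vanishing at both endpoints to continuous functions vanishing there, then to
  bounded measurable functions, and then to all square-integrable ones.
\<close>

section \<open>Absolutely continuous functions\<close>

text \<open>
  A tagged division is a finite set of pairs; this form of absolute continuity applies to it
  without an enumeration.
\<close>

lemma absolutely_continuous_on_finite_family:
  assumes "absolutely_continuous_on S f" "0 < \<epsilon>"
  obtains \<delta> where "0 < \<delta>"
    and "\<forall>(I::'i set) a b. finite I \<and> (\<forall>i\<in>I. a i \<le> b i \<and> {a i..b i} \<subseteq> S) \<and>
           disjoint_family_on (\<lambda>i. {a i<..<b i}) I \<and> (\<Sum>i\<in>I. b i - a i) < \<delta>
         \<longrightarrow> (\<Sum>i\<in>I. \<bar>f (b i) - f (a i)\<bar>) < \<epsilon>"
proof -
  obtain \<delta> where "0 < \<delta>" and \<delta>: "\<And>(n::nat) a b.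
      \<lbrakk>\<forall>i<n. a i \<le> b i \<and> {a i..b i} \<subseteq> S; disjoint_family_on (\<lambda>i. {a i<..<b i}) {..<n};
       (\<Sum>i<n. b i - a i) < \<delta>\<rbrakk> \<Longrightarrow> (\<Sum>i<n. \<bar>f (b i) - f (a i)\<bar>) < \<epsilon>"
    using assms unfolding absolutely_continuous_on_def by meson
  show thesis
  proof (rule that[OF \<open>0 < \<delta>\<close>], intro allI impI, elim conjE)
    fix I :: "'i set" and a b
    assume I: "finite I" "\<forall>i\<in>I. a i \<le> b i \<and> {a i..b i} \<subseteq> S"
      "disjoint_family_on (\<lambda>i. {a i<..<b i}) I" "(\<Sum>i\<in>I. b i - a i) < \<delta>"
    obtain h where h: "bij_betw h {..<card I} I"
      using ex_bij_betw_nat_finite[OF I(1)] by (auto simp: lessThan_atLeast0)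
    have reindex: "(\<Sum>i\<in>I. u i) = (\<Sum>k<card I. u (h k))" for u :: "'i \<Rightarrow> real"
      by (rule sum.reindex_bij_betw[OF h, symmetric])
    have "(\<Sum>k<card I. \<bar>f (b (h k)) - f (a (h k))\<bar>) < \<epsilon>"
    proof (rule \<delta>)
      show "\<forall>k<card I. a (h k) \<le> b (h k) \<and> {a (h k)..b (h k)} \<subseteq> S"
        using I(2) bij_betwE[OF h] by blast
      show "disjoint_family_on (\<lambda>k. {a (h k)<..<b (h k)}) {..<card I}"
        using I(3) bij_betwE[OF h] bij_betw_imp_inj_on[OF h]
        unfolding disjoint_family_on_def inj_on_def by blast
      show "(\<Sum>k<card I. b (h k) - a (h k)) < \<delta>"
        using I(4) reindex[of "\<lambda>i. b i - a i"] by simp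
    qed
    then show "(\<Sum>i\<in>I. \<bar>f (b i) - f (a i)\<bar>) < \<epsilon>"
      using reindex[of "\<lambda>i. \<bar>f (b i) - f (a i)\<bar>"] by simp
  qed
qed

lemma absolutely_continuous_on_imp_continuous_on:
  assumes "absolutely_continuous_on {a..b} f"
  shows "continuous_on {a..b} f"
  unfolding continuous_on_iff
proof (intro ballI allI impI)
  fix x and \<epsilon> :: real assume x: "x \<in> {a..b}" and "0 < \<epsilon>"
  obtain \<delta> where "0 < \<delta>" and \<delta>: "\<And>(n::nat) u v.
      \<lbrakk>\<forall>i<n. u i \<le> v i \<and> {u i..v i} \<subseteq> {a..b}; disjoint_family_on (\<lambda>i. {u i<..<v i}) {..<n};
       (\<Sum>i<n. v i - u i) < \<delta>\<rbrakk> \<Longrightarrow> (\<Sum>i<n. \<bar>f (v i) - f (u i)\<bar>) < \<epsilon>"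
    using assms \<open>0 < \<epsilon>\<close> unfolding absolutely_continuous_on_def by meson
  have close: "\<bar>f v - f u\<bar> < \<epsilon>" if "a \<le> u" "u \<le> v" "v \<le> b" "v - u < \<delta>" for u v
    using \<delta>[of 1 "\<lambda>_. u" "\<lambda>_. v"] that by (simp add: disjoint_family_on_def)
  show "\<exists>d>0. \<forall>y\<in>{a..b}. dist y x < d \<longrightarrow> dist (f y) (f x) < \<epsilon>"
  proof (intro exI[of _ \<delta>] conjI ballI impI \<open>0 < \<delta>\<close>)
    fix y assume "y \<in> {a..b}" "dist y x < \<delta>"
    then show "dist (f y) (f x) < \<epsilon>"
      using close[of x y] close[of y x] x by (cases "x \<le> y") (auto simp: dist_real_def)
  qed
qed

lemma absolutely_continuous_on_subset:
  assumes "absolutely_continuous_on T f" "S \<subseteq> T"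
  shows "absolutely_continuous_on S f"
  unfolding absolutely_continuous_on_def
proof (intro allI impI)
  fix \<epsilon> :: real assume "0 < \<epsilon>"
  then obtain \<delta> where "0 < \<delta>" and \<delta>: "\<And>(n::nat) a b.
      \<lbrakk>\<forall>i<n. a i \<le> b i \<and> {a i..b i} \<subseteq> T; disjoint_family_on (\<lambda>i. {a i<..<b i}) {..<n};
       (\<Sum>i<n. b i - a i) < \<delta>\<rbrakk> \<Longrightarrow> (\<Sum>i<n. \<bar>f (b i) - f (a i)\<bar>) < \<epsilon>"
    using assms(1) unfolding absolutely_continuous_on_def by meson
  show "\<exists>\<delta>>0. \<forall>(n::nat) a b. (\<forall>i<n. a i \<le> b i \<and> {a i..b i} \<subseteq> S) \<and>
        disjoint_family_on (\<lambda>i. {a i<..<b i}) {..<n} \<and> (\<Sum>i<n. b i - a i) < \<delta> \<longrightarrow>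
        (\<Sum>i<n. \<bar>f (b i) - f (a i)\<bar>) < \<epsilon>"
    using \<open>0 < \<delta>\<close> assms(2) by (intro exI[of _ \<delta>] conjI allI impI \<delta>) (simp_all, blast)
qed

lemma absolutely_continuous_on_const: "absolutely_continuous_on S (\<lambda>t. c)"
  unfolding absolutely_continuous_on_def by (auto intro: exI[of _ 1])

lemma absolutely_continuous_on_add:
  assumes "absolutely_continuous_on S f" "absolutely_continuous_on S g"
  shows "absolutely_continuous_on S (\<lambda>t. f t + g t)"
  unfolding absolutely_continuous_on_def
proof (intro allI impI)
  fix \<epsilon> :: real assume "0 < \<epsilon>"
  then have "0 < \<epsilon> / 2" by simp
  obtain \<delta>1 where d1: "0 < \<delta>1" "\<And>(n::nat) a b.
      \<lbrakk>\<forall>i<n. a i \<le> b i \<and> {a i..b i} \<subseteq> S; disjoint_family_on (\<lambda>i. {a i<..<b i}) {..<n};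
       (\<Sum>i<n. b i - a i) < \<delta>1\<rbrakk> \<Longrightarrow> (\<Sum>i<n. \<bar>f (b i) - f (a i)\<bar>) < \<epsilon> / 2"
    using assms(1) \<open>0 < \<epsilon> / 2\<close> unfolding absolutely_continuous_on_def by meson
  obtain \<delta>2 where d2: "0 < \<delta>2" "\<And>(n::nat) a b.
      \<lbrakk>\<forall>i<n. a i \<le> b i \<and> {a i..b i} \<subseteq> S; disjoint_family_on (\<lambda>i. {a i<..<b i}) {..<n};
       (\<Sum>i<n. b i - a i) < \<delta>2\<rbrakk> \<Longrightarrow> (\<Sum>i<n. \<bar>g (b i) - g (a i)\<bar>) < \<epsilon> / 2"
    using assms(2) \<open>0 < \<epsilon> / 2\<close> unfolding absolutely_continuous_on_def by meson
  show "\<exists>\<delta>>0. \<forall>(n::nat) a b. (\<forall>i<n. a i \<le> b i \<and> {a i..b i} \<subseteq> S) \<and>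
        disjoint_family_on (\<lambda>i. {a i<..<b i}) {..<n} \<and> (\<Sum>i<n. b i - a i) < \<delta> \<longrightarrow>
        (\<Sum>i<n. \<bar>f (b i) + g (b i) - (f (a i) + g (a i))\<bar>) < \<epsilon>"
  proof (intro exI[of _ "min \<delta>1 \<delta>2"] conjI allI impI)
    fix n :: nat and a b :: "nat \<Rightarrow> real"
    assume *: "(\<forall>i<n. a i \<le> b i \<and> {a i..b i} \<subseteq> S) \<and>
        disjoint_family_on (\<lambda>i. {a i<..<b i}) {..<n} \<and> (\<Sum>i<n. b i - a i) < min \<delta>1 \<delta>2"
    have "(\<Sum>i<n. \<bar>f (b i) + g (b i) - (f (a i) + g (a i))\<bar>)
        \<le> (\<Sum>i<n. \<bar>f (b i) - f (a i)\<bar> + \<bar>g (b i) - g (a i)\<bar>)"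
      by (intro sum_mono) linarith
    also have "\<dots> < \<epsilon>"
      using d1(2)[of n a b] d2(2)[of n a b] * by (simp add: sum.distrib)
    finally show "(\<Sum>i<n. \<bar>f (b i) + g (b i) - (f (a i) + g (a i))\<bar>) < \<epsilon>" .
  qed (use d1(1) d2(1) in auto)
qed

lemma absolutely_continuous_on_mult:
  assumes f: "absolutely_continuous_on {a..b} f" and g: "absolutely_continuous_on {a..b} g"
  shows "absolutely_continuous_on {a..b} (\<lambda>t. f t * g t)"
  unfolding absolutely_continuous_on_def
proof (intro allI impI)
  fix \<epsilon> :: real assume "0 < \<epsilon>"
  have "bounded (f ` {a..b})" "bounded (g ` {a..b})"
    using f g by (auto intro!: compact_imp_bounded compact_continuous_image
        absolutely_continuous_on_imp_continuous_on)
  then obtain B C where B: "0 < B" "\<And>t. t \<in> {a..b} \<Longrightarrow> \<bar>f t\<bar> \<le> B"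
    and C: "0 < C" "\<And>t. t \<in> {a..b} \<Longrightarrow> \<bar>g t\<bar> \<le> C"
    by (metis bounded_pos imageI real_norm_def)
  have "0 < \<epsilon> / (2 * C)" "0 < \<epsilon> / (2 * B)"
    using \<open>0 < \<epsilon>\<close> B C by auto
  obtain \<delta>1 where d1: "0 < \<delta>1" "\<And>(n::nat) u v.
      \<lbrakk>\<forall>i<n. u i \<le> v i \<and> {u i..v i} \<subseteq> {a..b}; disjoint_family_on (\<lambda>i. {u i<..<v i}) {..<n};
       (\<Sum>i<n. v i - u i) < \<delta>1\<rbrakk> \<Longrightarrow> (\<Sum>i<n. \<bar>f (v i) - f (u i)\<bar>) < \<epsilon> / (2 * C)"
    using f \<open>0 < \<epsilon> / (2 * C)\<close> unfolding absolutely_continuous_on_def by meson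
  obtain \<delta>2 where d2: "0 < \<delta>2" "\<And>(n::nat) u v.
      \<lbrakk>\<forall>i<n. u i \<le> v i \<and> {u i..v i} \<subseteq> {a..b}; disjoint_family_on (\<lambda>i. {u i<..<v i}) {..<n};
       (\<Sum>i<n. v i - u i) < \<delta>2\<rbrakk> \<Longrightarrow> (\<Sum>i<n. \<bar>g (v i) - g (u i)\<bar>) < \<epsilon> / (2 * B)"
    using g \<open>0 < \<epsilon> / (2 * B)\<close> unfolding absolutely_continuous_on_def by meson
  show "\<exists>\<delta>>0. \<forall>(n::nat) u v. (\<forall>i<n. u i \<le> v i \<and> {u i..v i} \<subseteq> {a..b}) \<and>
        disjoint_family_on (\<lambda>i. {u i<..<v i}) {..<n} \<and> (\<Sum>i<n. v i - u i) < \<delta> \<longrightarrow>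
        (\<Sum>i<n. \<bar>f (v i) * g (v i) - f (u i) * g (u i)\<bar>) < \<epsilon>"
  proof (intro exI[of _ "min \<delta>1 \<delta>2"] conjI allI impI)
    fix n :: nat and u v :: "nat \<Rightarrow> real"
    assume *: "(\<forall>i<n. u i \<le> v i \<and> {u i..v i} \<subseteq> {a..b}) \<and>
        disjoint_family_on (\<lambda>i. {u i<..<v i}) {..<n} \<and> (\<Sum>i<n. v i - u i) < min \<delta>1 \<delta>2"
    have "\<bar>f (v i) * g (v i) - f (u i) * g (u i)\<bar>
        \<le> B * \<bar>g (v i) - g (u i)\<bar> + C * \<bar>f (v i) - f (u i)\<bar>" if "i < n" for i
    proof -
      have "u i \<le> v i" "{u i..v i} \<subseteq> {a..b}" using * that by auto
      then have in_ab: "u i \<in> {a..b}" "v i \<in> {a..b}" by auto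
      \<comment> \<open>Each factor is bounded on the compact interval, so the increment of the product is
        dominated by the increments of the factors.\<close>
      have "f (v i) * g (v i) - f (u i) * g (u i)
          = f (v i) * (g (v i) - g (u i)) + g (u i) * (f (v i) - f (u i))"
        by (simp add: algebra_simps)
      also have "\<bar>\<dots>\<bar> \<le> \<bar>f (v i)\<bar> * \<bar>g (v i) - g (u i)\<bar> + \<bar>g (u i)\<bar> * \<bar>f (v i) - f (u i)\<bar>"
        by (metis abs_mult abs_triangle_ineq)
      also have "\<dots> \<le> B * \<bar>g (v i) - g (u i)\<bar> + C * \<bar>f (v i) - f (u i)\<bar>"
        using in_ab by (intro add_mono mult_right_mono B C) auto
      finally show ?thesis .
    qed
    then have "(\<Sum>i<n. \<bar>f (v i) * g (v i) - f (u i) * g (u i)\<bar>)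
        \<le> (\<Sum>i<n. B * \<bar>g (v i) - g (u i)\<bar> + C * \<bar>f (v i) - f (u i)\<bar>)"
      by (intro sum_mono) auto
    also have "\<dots> = B * (\<Sum>i<n. \<bar>g (v i) - g (u i)\<bar>) + C * (\<Sum>i<n. \<bar>f (v i) - f (u i)\<bar>)"
      by (simp add: sum.distrib sum_distrib_left)
    also have "\<dots> < B * (\<epsilon> / (2 * B)) + C * (\<epsilon> / (2 * C))"
      using d1(2)[of n u v] d2(2)[of n u v] * B(1) C(1)
      by (intro add_strict_mono mult_strict_left_mono) auto
    also have "\<dots> = \<epsilon>"
      using B(1) C(1) by simp
    finally show "(\<Sum>i<n. \<bar>f (v i) * g (v i) - f (u i) * g (u i)\<bar>) < \<epsilon>" .
  qed (use d1(1) d2(1) in auto)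
qed

section \<open>Integrating the derivative of an absolutely continuous function\<close>

text \<open>
  The usual straddle estimate shows that, at a tag outside \<open>N\<close>, the Riemann term differs from the
  increment of \<open>f\<close> by at most \<open>\<eta>\<close> times the length of the interval. At a tag in \<open>N\<close> the integrand may
  be replaced by \<open>0\<close>, so that only the increment of \<open>f\<close> remains. The gauge forces the intervals with
  such tags into an open set \<open>U \<supseteq> N\<close> of measure less than \<open>\<delta>\<close>. They do not overlap, so their total length is
  less than \<open>\<delta>\<close>, and absolute continuity bounds the sum of those increments.
\<close>

theorem absolutely_continuous_has_integral_derivative:
  fixes f :: "real \<Rightarrow> real"
  assumes "a \<le> b" and ac: "absolutely_continuous_on {a..b} f" and "negligible N"
    and deriv: "\<And>t. t \<in> {a..b} - N \<Longrightarrow> (f has_real_derivative g t) (at t within {a..b})"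
  shows "(g has_integral (f b - f a)) {a..b}"
proof -
  define g' where "g' t = (if t \<in> N then 0 else g t)" for t
  have "(g' has_integral (f b - f a)) {a..b}"
    unfolding has_integral_real
  proof (intro allI impI)
    fix e :: real assume "0 < e"
    \<comment> \<open>The summand \<open>1\<close> covers the degenerate interval \<open>a = b\<close>.\<close>
    define \<eta> where "\<eta> = e / (2 * (b - a + 1))"
    have "0 < \<eta>"
      using \<open>0 < e\<close> \<open>a \<le> b\<close> by (simp add: \<eta>_def)
    have "\<eta> * (b - a) \<le> \<eta> * (b - a + 1)"
      using \<open>0 < \<eta>\<close> by simp
    also have "\<dots> = e / 2"
      using \<open>a \<le> b\<close> by (simp add: \<eta>_def divide_simps)
    finally have \<eta>: "\<eta> * (b - a) \<le> e / 2" .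
    obtain \<delta> where "0 < \<delta>" and \<delta>:
      "\<forall>(I::(real \<times> real set) set) u v.
           finite I \<and> (\<forall>i\<in>I. u i \<le> v i \<and> {u i..v i} \<subseteq> {a..b}) \<and>
           disjoint_family_on (\<lambda>i. {u i<..<v i}) I \<and> (\<Sum>i\<in>I. v i - u i) < \<delta>
         \<longrightarrow> (\<Sum>i\<in>I. \<bar>f (v i) - f (u i)\<bar>) < e / 2"
      by (rule absolutely_continuous_on_finite_family[OF ac half_gt_zero[OF \<open>0 < e\<close>]])
    obtain U where U: "open U" "N \<subseteq> U" "U \<in> lmeasurable" "measure lebesgue U < \<delta>"
    proof -
      obtain U where U: "open U" "N \<subseteq> U" "U - N \<in> lmeasurable" "emeasure lebesgue (U - N) < ennreal \<delta>"
        using sets_lebesgue_outer_open[of N \<delta>] \<open>negligible N\<close> \<open>0 < \<delta>\<close> negligible_imp_sets by blast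
      have "N \<in> lmeasurable" "measure lebesgue N = 0"
        using \<open>negligible N\<close> by (auto simp: negligible_imp_measurable negligible_imp_measure0)
      have "U = (U - N) \<union> N" using U by auto
      then have "U \<in> lmeasurable"
        using U(3) \<open>N \<in> lmeasurable\<close> by (metis fmeasurable.Un)
      moreover have "measure lebesgue U \<le> measure lebesgue (U - N) + measure lebesgue N"
        using U(3) \<open>N \<in> lmeasurable\<close> \<open>U = _\<close>
        by (metis fmeasurableD measure_Un_le)
      moreover have "measure lebesgue (U - N) < \<delta>"
        using U(3,4) \<open>0 < \<delta>\<close> by (simp add: emeasure_eq_measure2 ennreal_less_iff)
      ultimately show thesis
        using that U \<open>measure lebesgue N = 0\<close> by auto
    qed
    have "\<exists>d>0. \<forall>y\<in>{a..b}. norm (y-t) < d \<longrightarrow> norm (f y - f t - g t * (y-t)) \<le> \<eta> * norm (y-t)"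
      if "t \<in> {a..b} - N" for t
      using deriv[OF that] \<open>0 < \<eta>\<close>
      unfolding has_field_derivative_def has_derivative_within_alt by blast
    then have "\<forall>t. \<exists>d>0. t \<in> {a..b} - N \<longrightarrow>
         (\<forall>y\<in>{a..b}. norm (y-t) < d \<longrightarrow> norm (f y - f t - g t * (y-t)) \<le> \<eta> * norm (y-t))"
      by (meson zero_less_one)
    then obtain d where "\<forall>t. 0 < d t \<and> (t \<in> {a..b} - N \<longrightarrow>
         (\<forall>y\<in>{a..b}. norm (y-t) < d t \<longrightarrow> norm (f y - f t - g t * (y-t)) \<le> \<eta> * norm (y-t)))"
      by (rule choice[THEN exE])
    then have d0: "\<And>t. 0 < d t"
      and d: "\<And>t y. \<lbrakk>t \<in> {a..b} - N; y \<in> {a..b}; norm (y-t) < d t\<rbrakk>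
                 \<Longrightarrow> norm (f y - f t - g t * (y-t)) \<le> \<eta> * norm (y-t)"
      by simp_all
    define \<gamma> where "\<gamma> t = (if t \<in> N then U else ball t (d t))" for t
    show "\<exists>\<gamma>. gauge \<gamma> \<and> (\<forall>p. p tagged_division_of {a..b} \<and> \<gamma> fine p \<longrightarrow>
            norm ((\<Sum>(x, k)\<in>p. measure lborel k *\<^sub>R g' x) - (f b - f a)) < e)"
    proof (intro exI[of _ \<gamma>] conjI allI impI)
      show "gauge \<gamma>"
        using U d0 by (auto simp: gauge_def \<gamma>_def)
    next
      fix p assume "p tagged_division_of {a..b} \<and> \<gamma> fine p"
      then have p: "p tagged_division_of {a..b}" and fine: "\<gamma> fine p" by auto
      have "finite p" using p by blast
      define I S where "I = (\<lambda>i::real \<times> real set. Inf (snd i))" and "S = (\<lambda>i::real \<times> real set. Sup (snd i))"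
      have K: "K = {Inf K..Sup K} \<and> Inf K \<le> t \<and> t \<le> Sup K \<and> K \<subseteq> {a..b} \<and> K \<subseteq> \<gamma> t" if "(t, K) \<in> p" for t K
      proof -
        have "\<exists>u v. K = cbox u v" using tagged_division_ofD(4)[OF p that] .
        moreover have "t \<in> K" "K \<subseteq> {a..b}" using tagged_division_ofD(2,3)[OF p that] by auto
        moreover have "K \<subseteq> \<gamma> t" using fine that by (auto simp: fine_def)
        ultimately show ?thesis by auto
      qed
      have ba: "b - a = (\<Sum>i\<in>p. S i - I i)" "f b - f a = (\<Sum>i\<in>p. f (S i) - f (I i))"
        using additive_tagged_division_1[OF \<open>a \<le> b\<close> p, of "\<lambda>x. x"]
          additive_tagged_division_1[OF \<open>a \<le> b\<close> p, of f]
        by (auto simp: case_prod_unfold I_def S_def)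
      \<comment> \<open>The part of the division whose tags lie in the exceptional set.\<close>
      define P where "P = {i\<in>p. fst i \<in> N}"
      have "P \<subseteq> p" "finite P" using \<open>finite p\<close> by (auto simp: P_def)
      define w where "w i = measure lborel (snd i) * g' (fst i) - (f (S i) - f (I i))" for i
      \<comment> \<open>The straddle estimate: compare the increment over \<open>[u, v]\<close> with those over \<open>[u, t]\<close> and \<open>[t, v]\<close>.\<close>
      have good: "\<bar>w i\<bar> \<le> \<eta> * (S i - I i)" if "i \<in> p - P" for i
      proof -
        obtain t K where i: "i = (t, K)" by (cases i)
        have tN: "t \<notin> N" and "(t, K) \<in> p" using that by (auto simp: P_def i)
        note K = K[OF this(2)]
        define u v where "u = Inf K" and "v = Sup K"
        have uv: "u \<le> t" "t \<le> v" and K_eq: "K = {u..v}" and "K \<subseteq> {a..b}" "K \<subseteq> ball t (d t)"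
          using K tN by (auto simp: u_def v_def \<gamma>_def)
        have mem: "u \<in> K" "v \<in> K" "t \<in> K" using uv K_eq by auto
        have *: "\<bar>f y - f t - g t * (y - t)\<bar> \<le> \<eta> * \<bar>y - t\<bar>" if "y \<in> K" for y
        proof -
          have "t \<in> {a..b} - N" "y \<in> {a..b}"
            using that mem tN \<open>K \<subseteq> {a..b}\<close> by auto
          moreover have "norm (y - t) < d t"
            using that \<open>K \<subseteq> ball t (d t)\<close> by (force simp: dist_real_def)
          ultimately show ?thesis
            using d by force
        qed
        have "w i = (f u - f t - g t * (u - t)) - (f v - f t - g t * (v - t))"
          using uv K_eq tN by (simp add: w_def i S_def I_def g'_def algebra_simps)
        also have "\<bar>\<dots>\<bar> \<le> \<eta> * \<bar>u - t\<bar> + \<eta> * \<bar>v - t\<bar>"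
          using *[OF mem(1)] *[OF mem(2)] by linarith
        also have "\<dots> = \<eta> * (S i - I i)"
          using uv by (simp add: i S_def I_def u_def v_def algebra_simps)
        finally show ?thesis .
      qed
      have disj: "disjoint_family_on (\<lambda>i. {I i<..<S i}) P"
        unfolding disjoint_family_on_def
      proof (intro ballI impI)
        fix i j assume "i \<in> P" "j \<in> P" "i \<noteq> j"
        then have "interior (snd i) \<inter> interior (snd j) = {}"
          using tagged_division_ofD(5)[OF p, of "fst i" "snd i" "fst j" "snd j"] \<open>P \<subseteq> p\<close>
          by (auto simp: prod_eq_iff)
        moreover have "interior (snd k) = {I k<..<S k}" if "k \<in> P" for k
          using K[of "fst k" "snd k"] that \<open>P \<subseteq> p\<close>
          by (metis I_def S_def interior_atLeastAtMost_real prod.collapse subsetD)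
        ultimately show "{I i<..<S i} \<inter> {I j<..<S j} = {}"
          using \<open>i \<in> P\<close> \<open>j \<in> P\<close> by simp
      qed
      have sub: "I i \<le> S i \<and> {I i..S i} \<subseteq> {a..b} \<and> {I i..S i} \<subseteq> U" if "i \<in> P" for i
      proof -
        have "(fst i, snd i) \<in> p" "fst i \<in> N" using that by (auto simp: P_def)
        then show ?thesis
          using K[of "fst i" "snd i"] by (auto simp: I_def S_def \<gamma>_def)
      qed
      have "(\<Sum>i\<in>P. S i - I i) = (\<Sum>i\<in>P. measure lebesgue {I i<..<S i})"
        using sub by (intro sum.cong) auto
      also have "\<dots> = measure lebesgue (\<Union>i\<in>P. {I i<..<S i})"
        using disj \<open>finite P\<close> by (intro measure_UNION'[symmetric])
          (auto simp: disjoint_family_on_def pairwise_def disjnt_def)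
      also have "\<dots> \<le> measure lebesgue U"
        using U(3) sub \<open>finite P\<close>
        by (intro measure_mono_fmeasurable) (force intro: sets.finite_UN)+
      finally have "(\<Sum>i\<in>P. S i - I i) < \<delta>" using U(4) by simp
      then have bad: "(\<Sum>i\<in>P. \<bar>f (S i) - f (I i)\<bar>) < e / 2"
        using \<open>finite P\<close> disj sub by (intro \<delta>[rule_format]) auto
      have "(\<Sum>(x, k)\<in>p. measure lborel k *\<^sub>R g' x) - (f b - f a) = (\<Sum>i\<in>p. w i)"
        unfolding ba(2) w_def by (simp add: sum_subtractf case_prod_unfold)
      also have "\<dots> = (\<Sum>i\<in>p - P. w i) + (\<Sum>i\<in>P. w i)"
        using \<open>P \<subseteq> p\<close> \<open>finite p\<close> by (simp add: sum.subset_diff)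
      also have "\<bar>\<dots>\<bar> \<le> (\<Sum>i\<in>p - P. \<bar>w i\<bar>) + (\<Sum>i\<in>P. \<bar>w i\<bar>)"
        by (intro order_trans[OF abs_triangle_ineq] add_mono sum_abs)
      also have "(\<Sum>i\<in>p - P. \<bar>w i\<bar>) \<le> (\<Sum>i\<in>p - P. \<eta> * (S i - I i))"
        by (intro sum_mono good)
      also have "\<dots> \<le> (\<Sum>i\<in>p. \<eta> * (S i - I i))"
      proof (intro sum_mono2 \<open>finite p\<close>)
        show "0 \<le> \<eta> * (S i - I i)" if "i \<in> p - (p - P)" for i
          using sub[of i] that \<open>0 < \<eta>\<close> by (simp add: zero_le_mult_iff)
      qed auto
      also have "\<dots> = \<eta> * (b - a)" by (simp add: ba(1) sum_distrib_left)
      also have "(\<Sum>i\<in>P. \<bar>w i\<bar>) = (\<Sum>i\<in>P. \<bar>f (S i) - f (I i)\<bar>)"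
        by (intro sum.cong) (auto simp: w_def g'_def P_def)
      finally show "norm ((\<Sum>(x, k)\<in>p. measure lborel k *\<^sub>R g' x) - (f b - f a)) < e"
        using bad \<eta> by simp
    qed
  qed
  then show ?thesis
    using \<open>negligible N\<close> by (rule has_integral_spike[rotated 2]) (auto simp: g'_def)
qed

section \<open>Indefinite integrals of square-integrable functions\<close>

text \<open>
  Almost everywhere the averages of an integrable function over \<open>[x, x + h]\<close> tend to its value at
  \<open>x\<close>, which is the right derivative. The left derivative is the right derivative for the reflected
  function \<open>t \<mapsto> f (- t)\<close> at \<open>- x\<close>, so the points to exclude there are the reflection of a null set.
\<close>

theorem indefinite_integral_has_derivative_ae:
  fixes f :: "real \<Rightarrow> real"
  assumes f: "f integrable_on {a..b}"
  obtains N where "negligible N"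
    "\<forall>t\<in>{a..b} - N. ((\<lambda>t. integral {a..t} f) has_real_derivative f t) (at t within {a..b})"
proof -
  \<comment> \<open>The averages near the endpoints need an integrand on the whole line.\<close>
  define g where "g t = (if t \<in> {a..b} then f t else 0)" for t
  have "g integrable_on UNIV"
    using f unfolding g_def integrable_restrict_UNIV .
  then have g: "g integrable_on cbox u v" for u v
    by (rule integrable_on_subcbox) simp
  have g': "(\<lambda>t. g (- t)) integrable_on cbox u v" for u v
    using g[of "- v" "- u"] by (metis integrable_reflect minus_minus)
  have quotients: "\<exists>N. negligible N \<and> (\<forall>x e. x \<notin> N \<and> 0 < e \<longrightarrow>
      (\<exists>d>0. \<forall>h. 0 < h \<and> h < d \<longrightarrow> \<bar>integral {x..x + h} k / h - k x\<bar> < e))"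
    if k: "\<And>u v. k integrable_on cbox u v" for k :: "real \<Rightarrow> real"
  proof -
    have eq: "norm (integral (cbox x (x + h *\<^sub>R One)) k /\<^sub>R h ^ DIM(real) - k x)
        = \<bar>integral {x..x + h} k / h - k x\<bar>" for x h
      by (simp add: divide_inverse_commute)
    show ?thesis
      by (rule integrable_ccontinuous_explicit[OF k, unfolded eq]) blast
  qed
  obtain N1 where N1: "negligible N1" "\<forall>x e. x \<notin> N1 \<and> 0 < e \<longrightarrow>
      (\<exists>d>0. \<forall>h. 0 < h \<and> h < d \<longrightarrow> \<bar>integral {x..x + h} g / h - g x\<bar> < e)"
    using quotients[OF g] by blast
  obtain N2 where N2: "negligible N2" "\<forall>x e. x \<notin> N2 \<and> 0 < e \<longrightarrow>
      (\<exists>d>0. \<forall>h. 0 < h \<and> h < d \<longrightarrow> \<bar>integral {x..x + h} (\<lambda>t. g (- t)) / h - g (- x)\<bar> < e)"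
    using quotients[OF g'] by blast
  have "negligible (N1 \<union> uminus ` N2)"
    using N1(1) N2(1)
    by (intro negligible_Un negligible_differentiable_image_negligible) (auto intro: differentiable_on_minus)
  then show thesis
  proof (rule that, intro ballI)
    fix x assume x: "x \<in> {a..b} - (N1 \<union> uminus ` N2)"
    then have "x \<notin> N1" "- x \<notin> N2" by (force simp: image_iff)+
    have diff: "integral {a..v} f - integral {a..u} f = integral {u..v} g"
      if "a \<le> u" "u \<le> v" "v \<le> b" for u v
    proof -
      have "f integrable_on {a..v}"
        using f that by (metis integrable_subinterval_real atLeastatMost_subset_iff order_refl)
      then have "integral {a..u} f + integral {u..v} f = integral {a..v} f"
        using that by (intro Henstock_Kurzweil_Integration.integral_combine) auto
      moreover have "integral {u..v} f = integral {u..v} g"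
        using that by (intro integral_cong) (auto simp: g_def)
      ultimately show ?thesis by simp
    qed
    show "((\<lambda>t. integral {a..t} f) has_real_derivative f x) (at x within {a..b})"
      unfolding has_field_derivative_iff Lim_within
    proof (intro allI impI)
      fix e :: real assume "0 < e"
      have "\<exists>d>0. \<forall>h. 0 < h \<and> h < d \<longrightarrow> \<bar>integral {x..x + h} g / h - g x\<bar> < e"
        using N1(2) \<open>x \<notin> N1\<close> \<open>0 < e\<close> by simp
      then obtain d1 where d1: "0 < d1" "\<And>h. 0 < h \<Longrightarrow> h < d1 \<Longrightarrow> \<bar>integral {x..x + h} g / h - g x\<bar> < e"
        by auto
      have "\<exists>d>0. \<forall>h. 0 < h \<and> h < d \<longrightarrow> \<bar>integral {- x..- x + h} (\<lambda>t. g (- t)) / h - g (- (- x))\<bar> < e"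
        using N2(2) \<open>- x \<notin> N2\<close> \<open>0 < e\<close> by blast
      then obtain d2 where d2: "0 < d2" "\<And>h. 0 < h \<Longrightarrow> h < d2 \<Longrightarrow>
           \<bar>integral {- x..- x + h} (\<lambda>t. g (- t)) / h - g x\<bar> < e"
        by auto
      show "\<exists>d>0. \<forall>y\<in>{a..b}. 0 < dist y x \<and> dist y x < d \<longrightarrow>
          dist ((integral {a..y} f - integral {a..x} f) / (y - x)) (f x) < e"
      proof (intro exI[of _ "min d1 d2"] conjI ballI impI)
        fix y assume y: "y \<in> {a..b}" "0 < dist y x \<and> dist y x < min d1 d2"
        have "f x = g x" using x by (simp add: g_def)
        consider "x < y" | "y < x" using y by fastforce
        then show "dist ((integral {a..y} f - integral {a..x} f) / (y - x)) (f x) < e"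
        proof cases
          case 1
          have "integral {a..y} f - integral {a..x} f = integral {x..x + (y - x)} g"
            using diff[of x y] 1 x y by simp
          moreover have "\<bar>integral {x..x + (y - x)} g / (y - x) - g x\<bar> < e"
            by (rule d1(2)) (use 1 y in \<open>simp_all add: dist_real_def\<close>)
          ultimately show ?thesis
            unfolding dist_real_def \<open>f x = g x\<close> by metis
        next
          case 2
          have "integral {a..x} f - integral {a..y} f = integral {y..x} g"
            using diff[of y x] 2 x y by simp
          also have "\<dots> = integral {- x..- x + (x - y)} (\<lambda>t. g (- t))"
            by simp
          finally have "(integral {a..y} f - integral {a..x} f) / (y - x)
              = integral {- x..- x + (x - y)} (\<lambda>t. g (- t)) / (x - y)"
            by (metis minus_diff_eq minus_divide_divide)
          moreover have "\<bar>integral {- x..- x + (x - y)} (\<lambda>t. g (- t)) / (x - y) - g x\<bar> < e"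
            by (rule d2(2)) (use 2 y in \<open>simp_all add: dist_real_def\<close>)
          ultimately show ?thesis
            unfolding dist_real_def \<open>f x = g x\<close> by metis
        qed
      qed (use d1(1) d2(1) in auto)
    qed
  qed
qed

text \<open>
  From \<open>\<bar>g\<bar> \<le> c g\<^sup>2 / 2 + 1 / (2 c)\<close> the increments over non-overlapping intervals of total length \<open>l\<close> add up
  to at most \<open>c E / 2 + l / (2 c)\<close> with \<open>E\<close> the integral of \<open>g\<^sup>2\<close>. The first summand is made small by the choice
  of \<open>c\<close>, and the second by \<open>l < c \<epsilon>\<close>.
\<close>

theorem indefinite_integral_absolutely_continuous:
  fixes g :: "real \<Rightarrow> real"
  assumes g: "g integrable_on {a..b}" and g2: "(\<lambda>t. (g t)\<^sup>2) integrable_on {a..b}"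
  shows "absolutely_continuous_on {a..b} (\<lambda>t. integral {a..t} g)"
  unfolding absolutely_continuous_on_def
proof (intro allI impI)
  fix \<epsilon> :: real assume "0 < \<epsilon>"
  define E where "E = integral {a..b} (\<lambda>t. (g t)\<^sup>2)"
  have "0 \<le> E" unfolding E_def by (intro integral_nonneg g2) auto
  define c where "c = \<epsilon> / (E + 1)"
  have "0 < c" and cE: "c * E < \<epsilon>"
    using \<open>0 < \<epsilon>\<close> \<open>0 \<le> E\<close> by (auto simp: c_def field_simps)
  show "\<exists>\<delta>>0. \<forall>(n::nat) u v. (\<forall>i<n. u i \<le> v i \<and> {u i..v i} \<subseteq> {a..b}) \<and>
        disjoint_family_on (\<lambda>i. {u i<..<v i}) {..<n} \<and> (\<Sum>i<n. v i - u i) < \<delta> \<longrightarrow>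
        (\<Sum>i<n. \<bar>integral {a..v i} g - integral {a..u i} g\<bar>) < \<epsilon>"
  proof (intro exI[of _ "c * \<epsilon>"] conjI allI impI)
    show "0 < c * \<epsilon>" using \<open>0 < c\<close> \<open>0 < \<epsilon>\<close> by simp
    fix n :: nat and u v :: "nat \<Rightarrow> real"
    assume *: "(\<forall>i<n. u i \<le> v i \<and> {u i..v i} \<subseteq> {a..b}) \<and>
        disjoint_family_on (\<lambda>i. {u i<..<v i}) {..<n} \<and> (\<Sum>i<n. v i - u i) < c * \<epsilon>"
    define J where "J i = integral {u i..v i} (\<lambda>t. (g t)\<^sup>2)" for i
    have int2: "(\<lambda>t. (g t)\<^sup>2) integrable_on {u i..v i}" if "i < n" for i
      using g2 * that by (metis integrable_subinterval_real)
    have bound: "\<bar>integral {a..v i} g - integral {a..u i} g\<bar> \<le> c / 2 * J i + (v i - u i) / (2 * c)"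
      if "i < n" for i
    proof -
      have uv: "u i \<le> v i" "{u i..v i} \<subseteq> {a..b}" using * that by auto
      have "g integrable_on {a..v i}"
        using g uv by (auto intro: integrable_subinterval_real)
      then have "integral {a..u i} g + integral {u i..v i} g = integral {a..v i} g"
        using uv by (intro Henstock_Kurzweil_Integration.integral_combine) auto
      then have "\<bar>integral {a..v i} g - integral {a..u i} g\<bar> = \<bar>integral {u i..v i} g\<bar>"
        by simp
      also have "\<dots> \<le> integral {u i..v i} (\<lambda>t. c / 2 * (g t)\<^sup>2 + 1 / (2 * c))"
        unfolding real_norm_def[symmetric]
      proof (rule integral_norm_bound_integral)
        show "g integrable_on {u i..v i}"
          using g uv by (metis integrable_subinterval_real)
        show "(\<lambda>t. c / 2 * (g t)\<^sup>2 + 1 / (2 * c)) integrable_on {u i..v i}"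
          using int2[OF that] by (intro integrable_add integrable_on_mult_right) auto
        show "norm (g t) \<le> c / 2 * (g t)\<^sup>2 + 1 / (2 * c)" for t
        proof -
          have "0 \<le> (c * \<bar>g t\<bar> - 1)\<^sup>2" by simp
          then show ?thesis using \<open>0 < c\<close>
            by (simp add: power2_eq_square field_simps)
        qed
      qed
      also have "\<dots> = c / 2 * J i + (v i - u i) / (2 * c)"
        using int2[OF that] uv unfolding J_def
        by (subst integral_add) (auto intro!: integrable_on_mult_right)
      finally show ?thesis .
    qed
    have "(\<Sum>i<n. J i) \<le> E"
    proof -
      have "((\<lambda>t. (g t)\<^sup>2) has_integral (\<Sum>i<n. J i)) (\<Union>i<n. {u i<..<v i})"
      proof (rule has_integral_UN)
        show "((\<lambda>t. (g t)\<^sup>2) has_integral J i) {u i<..<v i}" if "i \<in> {..<n}" for i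
          using int2[of i] that unfolding J_def
          by (metis has_integral_open_interval box_real integrable_integral lessThan_iff)
        show "pairwise (\<lambda>i i'. negligible ({u i<..<v i} \<inter> {u i'<..<v i'})) {..<n}"
          using * by (auto simp: pairwise_def disjoint_family_on_def)
      qed simp
      moreover have "((\<lambda>t. (g t)\<^sup>2) has_integral E) {a..b}"
        unfolding E_def using g2 by (rule integrable_integral)
      moreover have "(\<Union>i<n. {u i<..<v i}) \<subseteq> {a..b}"
        using * greaterThanLessThan_subseteq_atLeastAtMost_iff by fastforce
      ultimately show ?thesis
        by (intro has_integral_subset_le[where f = "\<lambda>t. (g t)\<^sup>2"]) auto
    qed
    have "(\<Sum>i<n. \<bar>integral {a..v i} g - integral {a..u i} g\<bar>)
        \<le> (\<Sum>i<n. c / 2 * J i + (v i - u i) / (2 * c))"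
      by (intro sum_mono bound) simp
    also have "\<dots> = c / 2 * (\<Sum>i<n. J i) + (\<Sum>i<n. v i - u i) / (2 * c)"
      by (simp add: sum.distrib sum_distrib_left sum_divide_distrib)
    also have "\<dots> < \<epsilon>"
    proof -
      have "c / 2 * (\<Sum>i<n. J i) \<le> c / 2 * E"
        using \<open>(\<Sum>i<n. J i) \<le> E\<close> \<open>0 < c\<close> by (intro mult_left_mono) auto
      moreover have "(\<Sum>i<n. v i - u i) / (2 * c) < \<epsilon> / 2"
        using * \<open>0 < c\<close> by (simp add: field_simps)
      ultimately show ?thesis using cE by simp
    qed
    finally show "(\<Sum>i<n. \<bar>integral {a..v i} g - integral {a..u i} g\<bar>) < \<epsilon>" .
  qed
qed

section \<open>Inverses of everywhere defined operators with an adjoint\<close>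

lemma gra_op_inverse_single: "gra (op_inverse (\<lambda>x. {S x})) = {(S y, y) |y. True}"
  by (auto simp: gra_def op_inverse_def)

lemma op_inverse_single: "op_inverse (\<lambda>x. {S x}) x = {y. S y = x}"
  by (auto simp: gra_def op_inverse_def)

text \<open>
  Both sides of each linearity equation have the same inner product with every vector.
\<close>

lemma linear_if_adjoint_pair:
  fixes S S' :: "'a::real_inner \<Rightarrow> 'a"
  assumes adj: "\<And>x y. inner (S x) y = inner x (S' y)"
  shows "linear S"
proof (rule linearI)
  show "S (x + y) = S x + S y" for x y
    by (rule vector_eq_rdot[THEN iffD1]) (simp add: adj inner_add_left)
  show "S (c *\<^sub>R x) = c *\<^sub>R S x" for c x
    by (rule vector_eq_rdot[THEN iffD1]) (simp add: adj)
qed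

text \<open>
  A pair \<open>(xs, - x)\<close> is orthogonal to all \<open>(S y, y)\<close> iff \<open>\<langle>y, S' xs\<rangle> = \<langle>y, x\<rangle>\<close> for all \<open>y\<close>.
\<close>

lemma op_adjoint_op_inverse:
  fixes S S' :: "'a::real_inner \<Rightarrow> 'a"
  assumes adj: "\<And>x y. inner (S x) y = inner x (S' y)"
  shows "op_adjoint (op_inverse (\<lambda>x. {S x})) = op_inverse (\<lambda>x. {S' x})"
proof -
  have "(xs, - x) \<in> (gra (op_inverse (\<lambda>x. {S x})))\<^sup>\<bottom> \<longleftrightarrow> S' xs = x" for x xs
  proof -
    have "(xs, - x) \<in> (gra (op_inverse (\<lambda>x. {S x})))\<^sup>\<bottom> \<longleftrightarrow> (\<forall>y. inner (S y) xs = inner y x)"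
      by (auto simp: orthogonal_comp_def orthogonal_def gra_op_inverse_single)
    also have "\<dots> \<longleftrightarrow> S' xs = x"
      by (auto simp: adj vector_eq_ldot)
    finally show ?thesis .
  qed
  then show ?thesis
    by (auto simp: op_adjoint_def op_inverse_single fun_eq_iff)
qed

lemma linear_operator_op_inverse:
  assumes "linear S" "inj S"
  shows "linear_operator (op_inverse (\<lambda>x. {S x}))"
proof -
  have "subspace {(S y, y) |y. True}"
    unfolding subspace_def
  proof (intro conjI ballI allI)
    show "0 \<in> {(S y, y) |y. True}"
      using linear_0[OF assms(1)] by (auto simp: zero_prod_def)
    show "p + q \<in> {(S y, y) |y. True}" if "p \<in> {(S y, y) |y. True}" "q \<in> {(S y, y) |y. True}" for p q
      using that linear_add[OF assms(1)] by auto
    show "c *\<^sub>R p \<in> {(S y, y) |y. True}" if "p \<in> {(S y, y) |y. True}" for c p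
      using that linear_scale[OF assms(1)] by auto
  qed
  then show ?thesis
    using assms(2)
    by (auto simp: linear_operator_def linear_relation_def gra_op_inverse_single
        at_most_single_valued_def op_inverse_single dest: injD)
qed

text \<open>
  This is Minty's argument. If \<open>(x, xs)\<close> is monotonically related to the graph, put \<open>w = x - S xs\<close> and
  test against the graph points with second component \<open>xs + s w\<close>. This gives
  \<open>\<langle>w, w\<rangle> \<le> s \<langle>S w, w\<rangle>\<close> for every \<open>s > 0\<close>, and \<open>s \<rightarrow> 0\<close> forces \<open>w = 0\<close>.
\<close>

lemma maximal_monotone_op_inverse:
  fixes S :: "'a::real_inner \<Rightarrow> 'a"
  assumes lin: "linear S" and mono: "\<And>x. 0 \<le> inner (S x) x"
  shows "maximal_monotone (op_inverse (\<lambda>x. {S x}))"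
  unfolding maximal_monotone_def
proof (intro conjI notI)
  show "monotone_op (op_inverse (\<lambda>x. {S x}))"
    using mono by (auto simp: monotone_op_def gra_op_inverse_single linear_diff[OF lin, symmetric])
next
  assume "\<exists>B. monotone_op B \<and> gra (op_inverse (\<lambda>x. {S x})) \<subset> gra B"
  then obtain B x xs where B: "monotone_op B" "gra (op_inverse (\<lambda>x. {S x})) \<subseteq> gra B"
    and x: "(x, xs) \<in> gra B" "(x, xs) \<notin> gra (op_inverse (\<lambda>x. {S x}))"
    by fast
  have related: "0 \<le> inner (x - S y) (xs - y)" for y
  proof -
    have "(S y, y) \<in> gra B"
      using B(2) by (auto simp: gra_op_inverse_single)
    then show ?thesis
      using B(1) x(1) by (fastforce simp: monotone_op_def)
  qed
  define w where "w = x - S xs"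
  have "s * inner w w \<le> s * (s * inner (S w) w)" for s
  proof -
    have "x - S (xs + s *\<^sub>R w) = w - s *\<^sub>R S w"
      by (simp add: w_def linear_add[OF lin] linear_scale[OF lin])
    then have "0 \<le> inner (w - s *\<^sub>R S w) (- (s *\<^sub>R w))"
      using related[of "xs + s *\<^sub>R w"] by simp
    then show ?thesis
      by (simp add: algebra_simps)
  qed
  then have small: "inner w w \<le> s * inner (S w) w" if "0 < s" for s
    using that by (metis mult_le_cancel_left_pos)
  have "inner w w \<le> 0"
  proof (rule tendsto_lowerbound)
    show "((\<lambda>s. s * inner (S w) w) \<longlongrightarrow> 0) (at_right 0)"
      by (auto intro!: tendsto_eq_intros)
    show "\<forall>\<^sub>F s in at_right 0. inner w w \<le> s * inner (S w) w"
      using small by (auto simp: eventually_at_right_less eventually_at_filter)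
  qed simp
  then have "S xs = x"
    unfolding w_def by (metis inner_gt_zero_iff not_le right_minus_eq)
  then show False
    using x(2) by (auto simp: gra_op_inverse_single)
qed

section \<open>Elements of the Hilbert space and their representatives\<close>

text \<open>
  Gauge integration works with negligible exceptional sets, the classes with the almost-everywhere
  filter; this translates between the two.
\<close>

lemma AE_lebesgue01_iff:
  "(AE t in lebesgue01. P t) \<longleftrightarrow> (\<exists>N. negligible N \<and> (\<forall>t\<in>{0..1} - N. P t))"
proof -
  have "(AE t in lebesgue01. P t) \<longleftrightarrow> (AE t in lebesgue. t \<in> {0..1} \<longrightarrow> P t)"
    by (simp add: AE_restrict_space_iff)
  also have "\<dots> \<longleftrightarrow> (\<exists>N. negligible N \<and> (\<forall>t\<in>{0..1} - N. P t))"
  proof -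
    have "{t \<in> space lebesgue. \<not> (t \<in> {0..1} \<longrightarrow> P t)} \<subseteq> N \<longleftrightarrow> (\<forall>t\<in>{0..1} - N. P t)" for N
      by auto
    then show ?thesis
      unfolding eventually_ae_filter negligible_iff_null_sets by (simp add: Bex_def)
  qed
  finally show ?thesis .
qed

lemma square_integrable01_rep: "square_integrable01 (rep_L2 x)"
  using Quotient3_rep_reflp[OF Quotient3_L2, of x] by (simp add: eq_L2_def)

lemma rep_abs_L2:
  assumes "square_integrable01 f"
  shows "AE t in lebesgue01. rep_L2 (abs_L2 f) t = f t"
proof -
  have "eq_L2 f (rep_L2 (abs_L2 f))"
    using assms by (intro rep_abs_rsp[OF Quotient3_L2]) (simp add: eq_L2_def)
  then have "AE t in lebesgue01. f t = rep_L2 (abs_L2 f) t"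
    by (simp add: eq_L2_def)
  then show ?thesis
    by eventually_elim simp
qed

lemma abs_rep_L2: "abs_L2 (rep_L2 x) = x"
  by (rule Quotient3_abs_rep[OF Quotient3_L2])

lemma L2_eqI:
  assumes "AE t in lebesgue01. rep_L2 x t = rep_L2 y t"
  shows "x = y"
  using assms Quotient3_rel_rep[OF Quotient3_L2, of x y]
  by (simp add: eq_L2_def square_integrable01_rep)

lemma abs_L2_eqI:
  assumes "square_integrable01 f" "AE t in lebesgue01. rep_L2 x t = f t"
  shows "x = abs_L2 f"
proof (rule L2_eqI)
  show "AE t in lebesgue01. rep_L2 x t = rep_L2 (abs_L2 f) t"
    using assms(2) rep_abs_L2[OF assms(1)] by eventually_elim simp
qed

lemma rep_L2_add: "AE t in lebesgue01. rep_L2 (x + y) t = rep_L2 x t + rep_L2 y t"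
  using rep_abs_L2[OF square_integrable01_add[OF square_integrable01_rep[of x] square_integrable01_rep[of y]]]
  by (simp add: plus_L2_def)

lemma rep_L2_scaleR: "AE t in lebesgue01. rep_L2 (c *\<^sub>R x) t = c * rep_L2 x t"
  using rep_abs_L2[OF square_integrable01_scale[OF square_integrable01_rep[of x], of c]]
  by (simp add: scaleR_L2_def)

lemma inner_L2_has_integral:
  assumes "AE t in lebesgue01. rep_L2 x t = f t" "AE t in lebesgue01. rep_L2 y t = g t"
  shows "((\<lambda>t. f t * g t) has_integral inner x y) {0..1}"
proof -
  have int: "((\<lambda>t. rep_L2 x t * rep_L2 y t) has_integral inner x y) {0..1}"
    unfolding inner_L2.rep_eq
    by (intro has_integral_integral_lebesgue_on square_integrable01_mult square_integrable01_rep) simp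
  have "AE t in lebesgue01. f t * g t = rep_L2 x t * rep_L2 y t"
    using assms by eventually_elim simp
  then obtain N where "negligible N" "\<And>t. t \<in> {0..1} - N \<Longrightarrow> f t * g t = rep_L2 x t * rep_L2 y t"
    unfolding AE_lebesgue01_iff by auto
  then show ?thesis
    using int by (rule has_integral_spike)
qed

lemma continuous_square_integrable01:
  assumes "continuous_on {0..1} f"
  shows "square_integrable01 f"
proof -
  have "continuous_on {0..1} (\<lambda>t. (f t)\<^sup>2)"
    using assms by (intro continuous_intros)
  then show ?thesis
    using continuous_imp_measurable_on_sets_lebesgue[OF assms] continuous_imp_integrable_real
    by (simp add: square_integrable01_def)
qed

text \<open>
  The nonnegative continuous function \<open>\<bar>f - g\<bar>\<close> has integral \<open>0\<close>.
\<close>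

lemma ae_equal_continuous_imp_equal:
  fixes f g :: "real \<Rightarrow> real"
  assumes f: "continuous_on {0..1} f" and g: "continuous_on {0..1} g"
    and "AE t in lebesgue01. f t = g t" and "t \<in> {0..1}"
  shows "f t = g t"
proof -
  obtain N where "negligible N" "\<forall>t\<in>{0..1} - N. f t = g t"
    using assms(3) unfolding AE_lebesgue01_iff by blast
  then have "((\<lambda>t. \<bar>f t - g t\<bar>) has_integral 0) {0..1}"
    by (intro has_integral_spike[OF _ _ has_integral_0, of N]) simp_all
  moreover have "continuous_on {0..1} (\<lambda>t. \<bar>f t - g t\<bar>)"
    using f g by (intro continuous_intros)
  ultimately have "\<forall>t\<in>{0..1}. \<bar>f t - g t\<bar> = 0"
    using integral_eq_0_iff[of 0 1 "\<lambda>t. \<bar>f t - g t\<bar>"] by (simp add: integral_unique)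
  then show ?thesis
    using \<open>t \<in> {0..1}\<close> by auto
qed

section \<open>Constants plus primitives\<close>

text \<open>
  This is the absolutely continuous representative of \<open>V y\<close>. Its values do not depend on the choice
  of the function in the class \<open>y\<close>.
\<close>

definition primitive :: "L2 \<Rightarrow> real \<Rightarrow> real" where
  "primitive y t = integral {0..t} (rep_L2 y)"

definition const1 :: L2 where
  "const1 = abs_L2 (\<lambda>t. 1)"

lemma rep_const1: "AE t in lebesgue01. rep_L2 const1 t = 1"
  unfolding const1_def by (intro rep_abs_L2 continuous_square_integrable01 continuous_on_const)

lemma rep_L2_integrable_on: "rep_L2 y integrable_on {0..1}"
  using has_integral_integral_lebesgue_on[OF square_integrable01_imp_integrable[OF square_integrable01_rep]]
  by (auto simp: integrable_on_def)

lemma rep_L2_square_integrable_on: "(\<lambda>t. (rep_L2 y t)\<^sup>2) integrable_on {0..1}"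
  using inner_L2_has_integral[of y "rep_L2 y" y "rep_L2 y"]
  by (auto simp: integrable_on_def power2_eq_square)

lemma primitive_0: "primitive y 0 = 0"
  by (simp add: primitive_def)

lemma primitive_1: "primitive y 1 = inner const1 y"
  using inner_L2_has_integral[OF rep_const1, of y "rep_L2 y"]
  by (simp add: primitive_def integral_unique)

lemma primitive_absolutely_continuous: "absolutely_continuous_on {0..1} (primitive y)"
  using indefinite_integral_absolutely_continuous[OF rep_L2_integrable_on rep_L2_square_integrable_on]
  by (simp add: primitive_def[abs_def])

lemma primitive_has_L2_derivative: "has_L2_derivative (primitive y) y"
proof -
  obtain N where "negligible N" "\<forall>t\<in>{0..1} - N.
      ((\<lambda>t. integral {0..t} (rep_L2 y)) has_real_derivative rep_L2 y t) (at t within {0..1})"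
    by (rule indefinite_integral_has_derivative_ae[OF rep_L2_integrable_on])
  then show ?thesis
    unfolding has_L2_derivative_def AE_lebesgue01_iff primitive_def[abs_def]
    by blast
qed

text \<open>
  The two sides involve the Lebesgue and the gauge integral of the same integrable function.
\<close>

lemma rep_volterra: "AE t in lebesgue01. rep_L2 (volterra y) t = primitive y t"
proof -
  have eq: "(LINT s|lebesgue_on {0..t}. rep_L2 y s) = primitive y t" if "t \<in> {0..1}" for t
    unfolding primitive_def
  proof (rule lebesgue_integral_eq_integral)
    show "integrable (lebesgue_on {0..t}) (rep_L2 y)"
      by (rule Equivalence_Lebesgue_Henstock_Integration.integrable_subinterval[of 0 1])
        (use square_integrable01_imp_integrable[OF square_integrable01_rep] that in auto)
  qed simp
  have cont: "continuous_on {0..1} (primitive y)"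
    by (intro absolutely_continuous_on_imp_continuous_on primitive_absolutely_continuous)
  have "continuous_on {0..1} (\<lambda>t. LINT s|lebesgue_on {0..t}. rep_L2 y s)"
    by (rule continuous_on_eq[OF cont]) (simp add: eq)
  then have "AE t in lebesgue01. rep_L2 (volterra y) t = (LINT s|lebesgue_on {0..t}. rep_L2 y s)"
    unfolding volterra_def map_fun_def comp_def
    by (intro rep_abs_L2 continuous_square_integrable01)
  then show ?thesis
    by (rule lebesgue_on_mono) (simp add: eq)
qed

lemma primitive_ftc:
  assumes ac: "absolutely_continuous_on {0..1} f" and deriv: "has_L2_derivative f y"
    and t: "t \<in> {0..1}"
  shows "f t = f 0 + primitive y t"
proof -
  obtain N where N: "negligible N"
    "\<And>s. s \<in> {0..1} - N \<Longrightarrow> (f has_real_derivative rep_L2 y s) (at s within {0..1})"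
    using deriv unfolding has_L2_derivative_def AE_lebesgue01_iff by blast
  have "(rep_L2 y has_integral (f t - f 0)) {0..t}"
  proof (rule absolutely_continuous_has_integral_derivative[OF _ _ N(1)])
    show "absolutely_continuous_on {0..t} f"
      using t by (intro absolutely_continuous_on_subset[OF ac]) simp
    show "(f has_real_derivative rep_L2 y s) (at s within {0..t})" if "s \<in> {0..t} - N" for s
      using N(2)[of s] that t by (intro DERIV_subset[OF N(2)]) auto
  qed (use t in auto)
  then show ?thesis
    by (simp add: primitive_def integral_unique)
qed

lemma has_L2_derivative_cong:
  assumes "\<And>t. t \<in> {0..1} \<Longrightarrow> f t = g t" "has_L2_derivative f y"
  shows "has_L2_derivative g y"
  using assms(2) unfolding has_L2_derivative_def
proof (rule lebesgue_on_mono)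
  show "(g has_real_derivative rep_L2 y t) (at t within {0..1})"
    if "(f has_real_derivative rep_L2 y t) (at t within {0..1})" "t \<in> {0..1}" for t
    using that assms(1) unfolding has_field_derivative_def
    by (metis has_derivative_transform)
qed

text \<open>
  No point of the interval is isolated, so one-sided derivatives at the endpoints are unique as well.
\<close>

lemma has_L2_derivative_unique:
  assumes "has_L2_derivative f y" "has_L2_derivative f z"
  shows "y = z"
proof (rule L2_eqI)
  have "AE t in lebesgue01. (f has_real_derivative rep_L2 y t) (at t within {0..1}) \<and>
       (f has_real_derivative rep_L2 z t) (at t within {0..1})"
    using assms unfolding has_L2_derivative_def by eventually_elim simp
  then show "AE t in lebesgue01. rep_L2 y t = rep_L2 z t"
  proof (rule lebesgue_on_mono)
    fix t :: real assume t: "t \<in> {0..1}"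
      and d: "(f has_real_derivative rep_L2 y t) (at t within {0..1}) \<and>
       (f has_real_derivative rep_L2 z t) (at t within {0..1})"
    have "at t within {0..1} \<noteq> bot"
      using t by (simp add: trivial_limit_within)
    then show "rep_L2 y t = rep_L2 z t"
      using d has_field_derivative_unique by blast
  qed
qed

lemma ac_representative_unique:
  assumes "ac_representative x f" "ac_representative x g" "t \<in> {0..1}"
  shows "f t = g t"
proof (rule ae_equal_continuous_imp_equal[OF _ _ _ assms(3)])
  show "continuous_on {0..1} f" "continuous_on {0..1} g"
    using assms absolutely_continuous_on_imp_continuous_on by (auto simp: ac_representative_def)
  have "AE t in lebesgue01. rep_L2 x t = f t" "AE t in lebesgue01. rep_L2 x t = g t"
    using assms by (auto simp: ac_representative_def)
  then show "AE t in lebesgue01. f t = g t"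
    by eventually_elim simp
qed

text \<open>
  The next three lemmas describe the Sobolev space of absolutely continuous elements with
  square-integrable derivative: it is parametrised by the initial value and the derivative.
\<close>

lemma ac_representative_const_add_volterra:
  "ac_representative (c *\<^sub>R const1 + volterra y) (\<lambda>t. c + primitive y t)"
  "has_L2_derivative (\<lambda>t. c + primitive y t) y"
proof -
  have "AE t in lebesgue01. rep_L2 (c *\<^sub>R const1 + volterra y) t = c + primitive y t"
    using rep_L2_add[of "c *\<^sub>R const1" "volterra y"] rep_L2_scaleR[of c const1] rep_const1 rep_volterra[of y]
    by eventually_elim simp
  then show "ac_representative (c *\<^sub>R const1 + volterra y) (\<lambda>t. c + primitive y t)"
    by (auto simp: ac_representative_def
        intro!: absolutely_continuous_on_add absolutely_continuous_on_const primitive_absolutely_continuous)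
  show "has_L2_derivative (\<lambda>t. c + primitive y t) y"
    using primitive_has_L2_derivative[of y] unfolding has_L2_derivative_def
    by eventually_elim (auto intro!: derivative_eq_intros)
qed

lemma ac_representative_imp_const_add_volterra:
  assumes "ac_representative x f" "has_L2_derivative f y"
  shows "x = f 0 *\<^sub>R const1 + volterra y"
proof (rule L2_eqI)
  have ac: "absolutely_continuous_on {0..1} f" and x: "AE t in lebesgue01. rep_L2 x t = f t"
    using assms(1) by (auto simp: ac_representative_def)
  have "AE t in lebesgue01. f t = f 0 + primitive y t"
    by (intro AE_I2 primitive_ftc[OF ac assms(2)]) auto
  moreover have "AE t in lebesgue01. rep_L2 (f 0 *\<^sub>R const1 + volterra y) t = f 0 + primitive y t"
    using ac_representative_const_add_volterra(1) by (simp add: ac_representative_def)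
  ultimately show "AE t in lebesgue01. rep_L2 x t = rep_L2 (f 0 *\<^sub>R const1 + volterra y) t"
    using x by eventually_elim simp
qed

lemma const_add_volterra_eq_iff:
  "c *\<^sub>R const1 + volterra y = d *\<^sub>R const1 + volterra z \<longleftrightarrow> c = d \<and> y = z"
proof
  assume eq: "c *\<^sub>R const1 + volterra y = d *\<^sub>R const1 + volterra z"
  have *: "c + primitive y t = d + primitive z t" if "t \<in> {0..1}" for t
    by (rule ac_representative_unique[OF ac_representative_const_add_volterra(1)[of c y, unfolded eq] ac_representative_const_add_volterra(1) that])
  show "c = d \<and> y = z"
  proof
    show "c = d" using *[of 0] by (simp add: primitive_0)
    show "y = z"
      using has_L2_derivative_cong[OF * ac_representative_const_add_volterra(2)] ac_representative_const_add_volterra(2)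
      by (rule has_L2_derivative_unique)
  qed
qed simp

section \<open>The adjoint of the Volterra operator\<close>

text \<open>
  The product of the primitives is absolutely continuous, vanishes at \<open>0\<close>, and at \<open>1\<close> equals the right
  hand side; the left hand side is the integral of its derivative.
\<close>

lemma volterra_integration_by_parts:
  "inner (volterra x) y + inner x (volterra y) = inner const1 x * inner const1 y"
proof -
  let ?F = "primitive x" and ?G = "primitive y"
  have "AE t in lebesgue01. ((\<lambda>t. ?F t * ?G t) has_real_derivative
      ?F t * rep_L2 y t + rep_L2 x t * ?G t) (at t within {0..1})"
    using primitive_has_L2_derivative[of x] primitive_has_L2_derivative[of y]
    unfolding has_L2_derivative_def
    by eventually_elim (auto intro!: derivative_eq_intros)
  then obtain N where "negligible N" "\<And>t. t \<in> {0..1} - N \<Longrightarrow>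
      ((\<lambda>t. ?F t * ?G t) has_real_derivative ?F t * rep_L2 y t + rep_L2 x t * ?G t) (at t within {0..1})"
    unfolding AE_lebesgue01_iff by blast
  then have "((\<lambda>t. ?F t * rep_L2 y t + rep_L2 x t * ?G t) has_integral ?F 1 * ?G 1 - ?F 0 * ?G 0) {0..1}"
    by (intro absolutely_continuous_has_integral_derivative[of _ _ "\<lambda>t. ?F t * ?G t"]
        absolutely_continuous_on_mult primitive_absolutely_continuous) auto
  moreover have "((\<lambda>t. ?F t * rep_L2 y t + rep_L2 x t * ?G t) has_integral
      inner (volterra x) y + inner x (volterra y)) {0..1}"
    by (intro has_integral_add inner_L2_has_integral rep_volterra) auto
  ultimately show ?thesis
    by (auto simp: primitive_0 primitive_1 dest: has_integral_unique)
qed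

text \<open>
  As \<open>\<langle>1, y\<rangle>\<close> is the integral of \<open>y\<close> over the whole interval, this is integration from \<open>t\<close> to \<open>1\<close>.
\<close>

definition volterra_adj :: "L2 \<Rightarrow> L2" where
  "volterra_adj y = inner const1 y *\<^sub>R const1 - volterra y"

lemma inner_volterra_adj: "inner (volterra x) y = inner x (volterra_adj y)"
  using volterra_integration_by_parts[of x y]
  by (simp add: volterra_adj_def inner_diff_right inner_commute[of x const1] algebra_simps)

lemma inner_volterra_self: "inner (volterra x) x = (inner const1 x)\<^sup>2 / 2"
  using volterra_integration_by_parts[of x x]
  by (simp add: inner_commute power2_eq_square)

lemma ac_representative_const_add_volterraD:
  assumes "ac_representative (c *\<^sub>R const1 + volterra y) f"
  shows "has_L2_derivative f y" "f 0 = c" "f 1 = c + inner const1 y"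
proof -
  have eq: "c + primitive y t = f t" if "t \<in> {0..1}" for t
    by (rule ac_representative_unique[OF ac_representative_const_add_volterra(1) assms that])
  show "has_L2_derivative f y"
    by (rule has_L2_derivative_cong[OF eq ac_representative_const_add_volterra(2)])
  show "f 0 = c" "f 1 = c + inner const1 y"
    using eq[of 0] eq[of 1] by (simp_all add: primitive_0 primitive_1)
qed

lemma linear_volterra: "linear volterra"
  by (rule linear_if_adjoint_pair[OF inner_volterra_adj])

lemma volterra_adj_eq_const_add_volterra: "volterra_adj z = inner const1 z *\<^sub>R const1 + volterra (- z)"
  by (simp add: volterra_adj_def linear_neg[OF linear_volterra])

lemma linear_volterra_adj: "linear volterra_adj"
  by (rule linear_if_adjoint_pair[of _ volterra]) (metis inner_volterra_adj inner_commute)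

lemma inj_volterra: "inj volterra"
  using const_add_volterra_eq_iff[of 0 _ 0] by (intro injI) simp

lemma inj_volterra_adj: "inj volterra_adj"
  unfolding volterra_adj_eq_const_add_volterra const_add_volterra_eq_iff inj_def by simp

lemma range_volterra_iff:
  "x \<in> range volterra \<longleftrightarrow> (\<exists>f. ac_representative x f \<and> f 0 = 0 \<and> (\<exists>y. has_L2_derivative f y))"
proof
  assume "x \<in> range volterra"
  then obtain y where "x = 0 *\<^sub>R const1 + volterra y" by auto
  then show "\<exists>f. ac_representative x f \<and> f 0 = 0 \<and> (\<exists>y. has_L2_derivative f y)"
    using ac_representative_const_add_volterra[of 0 y] ac_representative_const_add_volterraD[of 0 y] by metis
next
  assume "\<exists>f. ac_representative x f \<and> f 0 = 0 \<and> (\<exists>y. has_L2_derivative f y)"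
  then show "x \<in> range volterra"
    using ac_representative_imp_const_add_volterra by fastforce
qed

text \<open>
  Since \<open>V* z = \<langle>1, z\<rangle> 1 + V (- z)\<close>, the value at \<open>1\<close> is \<open>\<langle>1, z\<rangle> + \<langle>1, - z\<rangle> = 0\<close>. Conversely, a zero at \<open>1\<close> of
  \<open>c 1 + V y\<close> forces \<open>c = \<langle>1, - y\<rangle>\<close>.
\<close>

lemma range_volterra_adj_iff:
  "x \<in> range volterra_adj \<longleftrightarrow> (\<exists>f. ac_representative x f \<and> f 1 = 0 \<and> (\<exists>y. has_L2_derivative f y))"
proof
  assume "x \<in> range volterra_adj"
  then obtain z where x: "x = inner const1 z *\<^sub>R const1 + volterra (- z)"
    by (auto simp: volterra_adj_eq_const_add_volterra)
  obtain f where f: "ac_representative x f"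
    using ac_representative_const_add_volterra(1) x by blast
  then have "f 1 = 0" "has_L2_derivative f (- z)"
    using ac_representative_const_add_volterraD[of "inner const1 z" "- z" f] x by simp_all
  with f show "\<exists>f. ac_representative x f \<and> f 1 = 0 \<and> (\<exists>y. has_L2_derivative f y)"
    by blast
next
  assume "\<exists>f. ac_representative x f \<and> f 1 = 0 \<and> (\<exists>y. has_L2_derivative f y)"
  then obtain f y where f: "ac_representative x f" "f 1 = 0" "has_L2_derivative f y"
    by blast
  have x: "x = f 0 *\<^sub>R const1 + volterra y"
    using f by (intro ac_representative_imp_const_add_volterra)
  then have "f 1 = f 0 + inner const1 y"
    using ac_representative_const_add_volterraD(3)[of "f 0" y f] f(1) by simp
  then have "f 0 = inner const1 (- y)"
    using f(2) by simp
  then have "x = volterra_adj (- y)"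
    using x by (simp add: volterra_adj_eq_const_add_volterra)
  then show "x \<in> range volterra_adj"
    by blast
qed

text \<open>
  Comparison of coefficients in \<open>0 1 + V y = \<langle>1, z\<rangle> 1 + V (- z)\<close>. This decides the intersection of the domains,
  the skewness there, and the failure of symmetry.
\<close>

lemma volterra_eq_volterra_adj_iff:
  "volterra y = volterra_adj z \<longleftrightarrow> inner const1 y = 0 \<and> z = - y"
  using const_add_volterra_eq_iff[of 0 y "inner const1 z" "- z"]
  by (auto simp: volterra_adj_eq_const_add_volterra)

lemma range_volterra_Int_range_volterra_adj:
  "range volterra \<inter> range volterra_adj = volterra ` {y. inner const1 y = 0}"
  using volterra_eq_volterra_adj_iff by (auto simp: image_iff)

section \<open>Density\<close>

lemma norm_diff_abs_L2:
  assumes "square_integrable01 f" "square_integrable01 g"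
  shows "(norm (abs_L2 f - abs_L2 g))\<^sup>2 = (LINT t|lebesgue01. (f t - g t)\<^sup>2)"
proof -
  have sq: "square_integrable01 (\<lambda>t. - g t)" "square_integrable01 (\<lambda>t. f t + - g t)"
    using assms square_integrable01_add[OF assms(1) square_integrable01_uminus[OF assms(2)]]
    by (auto intro: square_integrable01_uminus)
  have "abs_L2 f - abs_L2 g = abs_L2 f + abs_L2 (\<lambda>t. - g t)"
    unfolding minus_L2_def using assms by (simp add: uminus_L2.abs_eq eq_L2_def)
  also have "\<dots> = abs_L2 (\<lambda>t. f t + - g t)"
    using assms sq by (intro plus_L2.abs_eq) (auto simp: eq_L2_def)
  finally show ?thesis
    using sq unfolding power2_norm_eq_inner by (simp add: inner_L2.abs_eq eq_L2_def power2_eq_square)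
qed

text \<open>
  By dominated convergence, the limit is one in norm. Allowing the approximants to lie in
  the closure lets the lemma be iterated.
\<close>

lemma closure_dominated_limit:
  assumes h: "\<And>n. square_integrable01 (h n)" "\<And>n. abs_L2 (h n) \<in> closure A"
    and f: "square_integrable01 f" and w: "square_integrable01 w"
    and lim: "AE t in lebesgue01. (\<lambda>n. h n t) \<longlonglongrightarrow> f t"
    and bound: "\<And>n t. t \<in> {0..1} \<Longrightarrow> \<bar>h n t\<bar> \<le> w t"
  shows "abs_L2 f \<in> closure A"
proof -
  have "(\<lambda>n. LINT t|lebesgue01. (h n t - f t)\<^sup>2) \<longlonglongrightarrow> (LINT t|lebesgue01. 0)"
  proof (rule integral_dominated_convergence)
    show "(\<lambda>t. (h n t - f t)\<^sup>2) \<in> borel_measurable lebesgue01" for n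
      using h(1)[of n] f by (auto simp: square_integrable01_def)
    show "integrable lebesgue01 (\<lambda>t. 4 * (w t)\<^sup>2)"
      using w by (auto simp: square_integrable01_def)
    show "AE t in lebesgue01. (\<lambda>n. (h n t - f t)\<^sup>2) \<longlonglongrightarrow> 0"
      using lim by eventually_elim (auto intro!: tendsto_eq_intros)
    show "AE t in lebesgue01. norm ((h n t - f t)\<^sup>2) \<le> 4 * (w t)\<^sup>2" for n
    proof (rule lebesgue_on_mono[OF lim])
      fix t :: real assume t: "t \<in> {0..1}" and "(\<lambda>n. h n t) \<longlonglongrightarrow> f t"
      then have "(\<lambda>n. \<bar>h n t\<bar>) \<longlonglongrightarrow> \<bar>f t\<bar>"
        by (intro tendsto_rabs)
      then have "\<bar>f t\<bar> \<le> w t"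
        using bound[OF t] by (intro LIMSEQ_le_const2) auto
      then have "\<bar>h n t - f t\<bar> \<le> 2 * w t"
        using bound[OF t, of n] by linarith
      then have "\<bar>h n t - f t\<bar>\<^sup>2 \<le> (2 * w t)\<^sup>2"
        by (intro power_mono) auto
      then show "norm ((h n t - f t)\<^sup>2) \<le> 4 * (w t)\<^sup>2"
        by (simp add: power_mult_distrib)
    qed
  qed simp
  then have "(\<lambda>n. (norm (abs_L2 (h n) - abs_L2 f))\<^sup>2) \<longlonglongrightarrow> 0"
    using norm_diff_abs_L2[OF h(1) f] by simp
  then have "(\<lambda>n. sqrt ((norm (abs_L2 (h n) - abs_L2 f))\<^sup>2)) \<longlonglongrightarrow> 0"
    using tendsto_real_sqrt by fastforce
  then have "(\<lambda>n. abs_L2 (h n)) \<longlonglongrightarrow> abs_L2 f"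
    by (simp add: tendsto_norm_zero_iff LIM_zero_iff)
  then show ?thesis
    by (rule closed_sequentially[OF closed_closure h(2)])
qed

text \<open>
  Such a function is \<open>V f'\<close>, and \<open>\<langle>1, f'\<rangle> = f 1 - f 0 = 0\<close>.
\<close>

lemma C1_in_volterra_image:
  assumes deriv: "\<And>t. (f has_real_derivative f' t) (at t)" and cont: "continuous_on {0..1} f'"
    and "f 0 = 0" "f 1 = 0"
  shows "abs_L2 f \<in> volterra ` {y. inner const1 y = 0}"
proof -
  define y where "y = abs_L2 f'"
  obtain N where N: "negligible N" "\<forall>t\<in>{0..1} - N. rep_L2 y t = f' t"
    using rep_abs_L2[OF continuous_square_integrable01[OF cont]]
    unfolding y_def AE_lebesgue01_iff by blast
  have prim: "primitive y t = f t" if "t \<in> {0..1}" for t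
  proof -
    have "(f' has_integral (f t - f 0)) {0..t}"
      using that deriv
      by (intro fundamental_theorem_of_calculus)
        (auto simp: has_real_derivative_iff_has_vector_derivative[symmetric] intro: has_field_derivative_at_within)
    then have "(rep_L2 y has_integral (f t - f 0)) {0..t}"
      by (rule has_integral_spike[OF N(1), rotated]) (use N(2) that in auto)
    then show ?thesis
      using \<open>f 0 = 0\<close> by (simp add: primitive_def integral_unique)
  qed
  have "continuous_on {0..1} f"
    using deriv by (meson DERIV_isCont continuous_at_imp_continuous_on)
  moreover have "AE t in lebesgue01. rep_L2 (volterra y) t = f t"
    using rep_volterra[of y] by (rule lebesgue_on_mono) (simp add: prim)
  ultimately have "volterra y = abs_L2 f"
    by (intro abs_L2_eqI continuous_square_integrable01)
  moreover have "inner const1 y = 0"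
    using prim[of 1] \<open>f 1 = 0\<close> by (simp add: primitive_1)
  ultimately show ?thesis
    by (metis (mono_tags) image_eqI mem_Collect_eq)
qed

lemma continuous_in_closure_volterra_image:
  assumes h: "continuous_on {0..1} h" and "h 0 = 0" "h 1 = 0"
  shows "abs_L2 h \<in> closure (volterra ` {y. inner const1 y = 0})"
proof -
  have "\<exists>g. real_polynomial_function g \<and> (\<forall>t\<in>{0..1}. \<bar>h t - g t\<bar> < inverse (real (Suc n)))" for n
    by (rule Stone_Weierstrass_real_polynomial_function[OF compact_Icc h, of "inverse (real (Suc n))"])
      (simp, blast)
  then obtain g where g: "\<And>n. real_polynomial_function (g n)"
    and near: "\<And>n t. t \<in> {0..1} \<Longrightarrow> \<bar>h t - g n t\<bar> < inverse (real (Suc n))"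
    by metis
  \<comment> \<open>Subtracting the chord of \<open>g n\<close> restores the boundary values. The chord is uniformly small
    because \<open>h\<close> vanishes at both endpoints.\<close>
  define q where "q n t = g n t - (g n 0 * (1 - t) + g n 1 * t)" for n t
  have dist: "\<bar>q n t - h t\<bar> \<le> 2 * inverse (real (Suc n))" if t: "t \<in> {0..1}" for n t
  proof -
    have "\<bar>g n 0 * (1 - t) + g n 1 * t\<bar> \<le> \<bar>g n 0\<bar> * (1 - t) + \<bar>g n 1\<bar> * t"
      using t abs_triangle_ineq[of "g n 0 * (1 - t)" "g n 1 * t"] by (simp add: abs_mult)
    also have "\<dots> \<le> inverse (real (Suc n)) * (1 - t) + inverse (real (Suc n)) * t"
      using near[of 0 n] near[of 1 n] assms(2,3) t by (intro add_mono mult_right_mono) auto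
    also have "\<dots> = inverse (real (Suc n))"
      by (simp add: algebra_simps)
    finally show ?thesis
      using near[OF t, of n] by (simp add: q_def)
  qed
  have qC: "continuous_on {0..1} (q n)" "abs_L2 (q n) \<in> volterra ` {y. inner const1 y = 0}" for n
  proof -
    obtain g' where g': "real_polynomial_function g'" "\<And>t. (g n has_real_derivative g' t) (at t)"
      using has_real_derivative_polynomial_function[OF g[of n]] by blast
    have q': "(q n has_real_derivative g' t - (g n 1 - g n 0)) (at t)" for t
      unfolding q_def by (auto intro!: derivative_eq_intros g'(2))
    show "abs_L2 (q n) \<in> volterra ` {y. inner const1 y = 0}"
    proof (rule C1_in_volterra_image[OF q'])
      show "continuous_on {0..1} (\<lambda>t. g' t - (g n 1 - g n 0))"
        using g'(1) by (intro continuous_intros continuous_on_polymonial_function)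
          (simp add: real_polynomial_function_eq)
    qed (simp_all add: q_def)
    show "continuous_on {0..1} (q n)"
      using q' by (meson DERIV_isCont continuous_at_imp_continuous_on)
  qed
  obtain B where B: "\<And>t. t \<in> {0..1} \<Longrightarrow> \<bar>h t\<bar> \<le> B"
    using compact_imp_bounded[OF compact_continuous_image[OF h compact_Icc]]
    unfolding bounded_iff by (metis imageI real_norm_def)
  show ?thesis
  proof (rule closure_dominated_limit[where h = q and w = "\<lambda>t. B + 2"])
    show "AE t in lebesgue01. (\<lambda>n. q n t) \<longlonglongrightarrow> h t"
    proof (intro AE_I2)
      fix t assume "t \<in> space lebesgue01"
      then have t: "t \<in> {0..1}" by simp
      have "(\<lambda>n. q n t - h t) \<longlonglongrightarrow> 0"
      proof (rule Lim_null_comparison)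
        show "\<forall>\<^sub>F n in sequentially. norm (q n t - h t) \<le> 2 * inverse (real (Suc n))"
          using dist[OF t] by simp
        show "(\<lambda>n. 2 * inverse (real (Suc n))) \<longlonglongrightarrow> 0"
          using tendsto_mult_right_zero[OF LIMSEQ_inverse_real_of_nat] .
      qed
      then show "(\<lambda>n. q n t) \<longlonglongrightarrow> h t"
        by (simp add: LIM_zero_iff)
    qed
    show "\<bar>q n t\<bar> \<le> B + 2" if "t \<in> {0..1}" for n t
    proof -
      have "inverse (real (Suc n)) \<le> 1" by (simp add: inverse_le_1_iff)
      then show ?thesis using dist[OF that, of n] B[OF that] by linarith
    qed
    show "abs_L2 (q n) \<in> closure (volterra ` {y. inner const1 y = 0})" for n
      using qC(2) closure_subset by (rule rev_subsetD)
  qed (use qC(1) h in \<open>auto intro: continuous_square_integrable01\<close>)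
qed

text \<open>
  A measurable function is almost everywhere a limit of continuous ones. To make these bounded and
  zero at the endpoints, they are clamped to \<open>[- M, M]\<close> and multiplied by cutoffs
  \<open>min 1 (n t (1 - t))\<close>, which tend to \<open>1\<close> on the open interval. The limit is the function clamped to
  \<open>[- M, M]\<close>; a second dominated limit, \<open>M \<rightarrow> \<infinity>\<close>, removes the clamping.
\<close>

lemma volterra_image_dense: "closure (volterra ` {y. inner const1 y = 0}) = UNIV"
proof -
  let ?D = "volterra ` {y. inner const1 y = 0}"
  define clamp where "clamp M s = max (- M) (min M s)" for M s :: real
  have clamp_le: "\<bar>clamp M s\<bar> \<le> M" "\<bar>clamp M s\<bar> \<le> \<bar>s\<bar>" if "0 \<le> M" for M s
    using that by (auto simp: clamp_def)
  have "x \<in> closure ?D" for x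
  proof -
    let ?r = "rep_L2 x"
    have r: "?r \<in> borel_measurable lebesgue01"
      using square_integrable01_rep by (simp add: square_integrable01_def)
    obtain N g where "negligible N" and g: "\<And>n. continuous_on UNIV (g n)"
      and lim_g: "\<And>t. t \<notin> N \<Longrightarrow> (\<lambda>n. g n t) \<longlonglongrightarrow> (if t \<in> {0..1} then ?r t else 0)"
      using r measurable_on_iff_borel_measurable[of "{0..1}" ?r] unfolding measurable_on_def by auto
    have clamp_r: "square_integrable01 (\<lambda>t. clamp M (?r t))" if "0 \<le> M" for M
      unfolding square_integrable01_def
    proof
      show meas: "(\<lambda>t. clamp M (?r t)) \<in> borel_measurable lebesgue01"
        unfolding clamp_def using r by measurable
      show "integrable lebesgue01 (\<lambda>t. (clamp M (?r t))\<^sup>2)"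
      proof (rule Bochner_Integration.integrable_bound)
        show "integrable lebesgue01 (\<lambda>t. (?r t)\<^sup>2)"
          using square_integrable01_rep by (simp add: square_integrable01_def)
        show "AE t in lebesgue01. norm ((clamp M (?r t))\<^sup>2) \<le> norm ((?r t)\<^sup>2)"
          using clamp_le(2)[OF that] by (intro AE_I2) (simp add: abs_le_square_iff[symmetric])
      qed (use meas in measurable)
    qed
    have bounded: "abs_L2 (\<lambda>t. clamp M (?r t)) \<in> closure ?D" if "0 \<le> M" for M
    proof -
      define cutoff where "cutoff n t = min 1 (real n * (t * (1 - t)))" for n and t :: real
      have cutoff: "0 \<le> cutoff n t" "cutoff n t \<le> 1" if "t \<in> {0..1}" for n t
        using that by (auto simp: cutoff_def)
      define h where "h n t = clamp M (g n t) * cutoff n t" for n t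
      have h: "continuous_on {0..1} (h n)" for n
        unfolding h_def clamp_def cutoff_def
        by (intro continuous_intros continuous_on_subset[OF g]) auto
      have "abs_L2 (\<lambda>t. clamp M (?r t)) \<in> closure ?D"
      proof (rule closure_dominated_limit[where h = h and w = "\<lambda>t. M"])
        show "AE t in lebesgue01. (\<lambda>n. h n t) \<longlonglongrightarrow> clamp M (?r t)"
          unfolding AE_lebesgue01_iff
        proof (intro exI[of _ "N \<union> {0, 1}"] conjI ballI)
          show "negligible (N \<union> {0, 1})"
            using \<open>negligible N\<close> by (intro negligible_Un) auto
          fix t assume t: "t \<in> {0..1} - (N \<union> {0, 1})"
          have "(\<lambda>n. cutoff n t) \<longlonglongrightarrow> 1"
          proof (rule tendsto_eventually)
            have "0 < t * (1 - t)" using t by auto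
            then obtain n0 where "1 < real n0 * (t * (1 - t))"
              using reals_Archimedean3 by blast
            then have "1 \<le> real n * (t * (1 - t))" if "n0 \<le> n" for n
              using that \<open>0 < t * (1 - t)\<close>
              by (meson less_imp_le mult_right_mono of_nat_mono order_trans)
            then show "\<forall>\<^sub>F n in sequentially. cutoff n t = 1"
              unfolding cutoff_def eventually_sequentially by (metis min_def)
          qed
          moreover have "(\<lambda>n. clamp M (g n t)) \<longlonglongrightarrow> clamp M (?r t)"
            unfolding clamp_def using lim_g[of t] t by (auto intro!: tendsto_intros)
          ultimately show "(\<lambda>n. h n t) \<longlonglongrightarrow> clamp M (?r t)"
            unfolding h_def using tendsto_mult[of _ "clamp M (?r t)" _ _ 1] by simp
        qed
        show "\<bar>h n t\<bar> \<le> M" if "t \<in> {0..1}" for n t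
          using mult_mono[OF clamp_le(1)[OF \<open>0 \<le> M\<close>] cutoff(2)[OF that]] cutoff(1)[OF that] \<open>0 \<le> M\<close>
          by (simp add: h_def abs_mult)
        show "abs_L2 (h n) \<in> closure ?D" for n
          using continuous_in_closure_volterra_image[OF h] by (simp add: h_def cutoff_def)
      qed (use h clamp_r[OF that] in \<open>auto intro: continuous_square_integrable01\<close>)
      then show ?thesis by simp
    qed
    have "abs_L2 ?r \<in> closure ?D"
    proof (rule closure_dominated_limit[where h = "\<lambda>n t. clamp (real n) (?r t)" and w = "\<lambda>t. \<bar>?r t\<bar>"])
      show "AE t in lebesgue01. (\<lambda>n. clamp (real n) (?r t)) \<longlonglongrightarrow> ?r t"
      proof (intro AE_I2 tendsto_eventually)
        fix t
        obtain n0 where "\<bar>?r t\<bar> \<le> real n0" using real_arch_simple by blast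
        then have "clamp (real n) (?r t) = ?r t" if "n0 \<le> n" for n
          using that by (auto simp: clamp_def)
        then show "\<forall>\<^sub>F n in sequentially. clamp (real n) (?r t) = ?r t"
          unfolding eventually_sequentially by blast
      qed
      show "square_integrable01 (\<lambda>t. \<bar>?r t\<bar>)"
        using square_integrable01_rep[of x] by (auto simp: square_integrable01_def)
    qed (use bounded clamp_r clamp_le square_integrable01_rep in auto)
    then show ?thesis by (simp add: abs_rep_L2)
  qed
  then show ?thesis by auto
qed

section \<open>The inverse of the Volterra operator\<close>

theorem theorem4p5:
  fixes T :: "L2 \<Rightarrow> L2 set" and D :: "L2 set"
  assumes T_def: "T = op_inverse (\<lambda>x. {volterra x})"
    and D_def: "D = op_dom T \<inter> op_dom (op_adjoint T)"
  shows
    "(\<comment> \<open>(i)\<close>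
      op_dom T = {x. \<exists>f. ac_representative x f \<and> f 0 = 0 \<and> (\<exists>y. has_L2_derivative f y)} \<and>
      (\<forall>x\<in>op_dom T. \<forall>f. ac_representative x f \<longrightarrow>
         (\<exists>y. has_L2_derivative f y \<and> T x = {y})) \<and>
      op_dom (op_adjoint T) =
        {x. \<exists>f. ac_representative x f \<and> f 1 = 0 \<and> (\<exists>y. has_L2_derivative f y)} \<and>
      (\<forall>x\<in>op_dom (op_adjoint T). \<forall>f. ac_representative x f \<longrightarrow>
         (\<exists>y. has_L2_derivative f y \<and> op_adjoint T x = {- y})) \<and>
      linear_operator T \<and> maximal_monotone T \<and>
      linear_operator (op_adjoint T) \<and> maximal_monotone (op_adjoint T)) \<and>
     (\<comment> \<open>(ii)\<close>
      \<not> skew_op T \<and> \<not> symmetric_op T) \<and>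
     (\<comment> \<open>(iii)\<close>
      D = {x. \<exists>f. ac_representative x f \<and> f 0 = 0 \<and> f 1 = 0 \<and> (\<exists>y. has_L2_derivative f y)} \<and>
      subspace D \<and> closure D = UNIV \<and>
      skew_op_on D T \<and> skew_op_on D (op_adjoint T))"
proof -
  have adj: "op_adjoint T = op_inverse (\<lambda>x. {volterra_adj x})"
    unfolding T_def by (rule op_adjoint_op_inverse[OF inner_volterra_adj])
  have T: "T x = {y. volterra y = x}" and T': "op_adjoint T x = {y. volterra_adj y = x}" for x
    unfolding T_def adj[unfolded T_def] by (rule op_inverse_single)+
  have dom: "op_dom T = range volterra" and dom': "op_dom (op_adjoint T) = range volterra_adj"
    by (auto simp: op_dom_def T T')
  have D: "D = volterra ` {y. inner const1 y = 0}"
    unfolding D_def dom dom' by (rule range_volterra_Int_range_volterra_adj)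
  have "const1 \<noteq> 0"
    using const_add_volterra_eq_iff[of 1 0 0 0] by auto
  then have unit: "inner const1 const1 \<noteq> 0"
    by simp
  show ?thesis
  proof (intro conjI)
    show "op_dom T = {x. \<exists>f. ac_representative x f \<and> f 0 = 0 \<and> (\<exists>y. has_L2_derivative f y)}"
      unfolding dom by (intro set_eqI) (simp only: range_volterra_iff mem_Collect_eq)
    show "op_dom (op_adjoint T) = {x. \<exists>f. ac_representative x f \<and> f 1 = 0 \<and> (\<exists>y. has_L2_derivative f y)}"
      unfolding dom' by (intro set_eqI) (simp only: range_volterra_adj_iff mem_Collect_eq)
    show "\<forall>x\<in>op_dom T. \<forall>f. ac_representative x f \<longrightarrow> (\<exists>y. has_L2_derivative f y \<and> T x = {y})"
    proof (intro ballI allI impI)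
      fix x f assume "x \<in> op_dom T" and f: "ac_representative x f"
      then obtain y where x: "x = volterra y" by (auto simp: dom)
      have "T x = {y}"
        using injD[OF inj_volterra] by (auto simp: T x)
      moreover have "has_L2_derivative f y"
        using ac_representative_const_add_volterraD(1)[of 0 y f] f x by simp
      ultimately show "\<exists>y. has_L2_derivative f y \<and> T x = {y}" by blast
    qed
    show "\<forall>x\<in>op_dom (op_adjoint T). \<forall>f. ac_representative x f \<longrightarrow>
         (\<exists>y. has_L2_derivative f y \<and> op_adjoint T x = {- y})"
    proof (intro ballI allI impI)
      fix x f assume "x \<in> op_dom (op_adjoint T)" and f: "ac_representative x f"
      then obtain z where x: "x = volterra_adj z" by (auto simp: dom')
      have "op_adjoint T x = {- (- z)}"
        using injD[OF inj_volterra_adj] by (auto simp: T' x)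
      moreover have "has_L2_derivative f (- z)"
        using ac_representative_const_add_volterraD(1) f x by (simp add: volterra_adj_eq_const_add_volterra)
      ultimately show "\<exists>y. has_L2_derivative f y \<and> op_adjoint T x = {- y}" by blast
    qed
    show "linear_operator T"
      unfolding T_def by (rule linear_operator_op_inverse[OF linear_volterra inj_volterra])
    show "linear_operator (op_adjoint T)"
      unfolding adj by (rule linear_operator_op_inverse[OF linear_volterra_adj inj_volterra_adj])
    show "maximal_monotone T"
      unfolding T_def by (rule maximal_monotone_op_inverse[OF linear_volterra]) (simp add: inner_volterra_self)
    show "maximal_monotone (op_adjoint T)"
      unfolding adj
    proof (rule maximal_monotone_op_inverse[OF linear_volterra_adj])
      show "0 \<le> inner (volterra_adj x) x" for x
      proof -
        have "0 \<le> (inner const1 x)\<^sup>2 / 2"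
          by simp
        also have "\<dots> = inner (volterra_adj x) x"
          by (metis inner_commute inner_volterra_adj inner_volterra_self)
        finally show ?thesis .
      qed
    qed
    show "\<not> skew_op T"
    proof
      assume "skew_op T"
      then have "inner (volterra const1) const1 = 0"
        by (auto simp: skew_op_def gra_def T)
      then show False using unit by (simp add: inner_volterra_self)
    qed
    \<comment> \<open>Symmetry would give \<open>V 1 = V* 1\<close>, which requires \<open>\<langle>1, 1\<rangle> = 0\<close>.\<close>
    show "\<not> symmetric_op T"
    proof
      assume "symmetric_op T"
      then have "(volterra const1, const1) \<in> gra (op_adjoint T)"
        by (auto simp: symmetric_op_def gra_def T)
      then have "volterra const1 = volterra_adj const1"
        by (simp add: gra_def T')
      then show False
        using unit by (simp add: volterra_eq_volterra_adj_iff)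
    qed
    show "D = {x. \<exists>f. ac_representative x f \<and> f 0 = 0 \<and> f 1 = 0 \<and> (\<exists>y. has_L2_derivative f y)}"
    proof (intro set_eqI iffI)
      fix x assume "x \<in> D"
      then have "x \<in> range volterra" "x \<in> range volterra_adj"
        by (auto simp: D_def dom dom')
      then obtain f f1 where "ac_representative x f" "f 0 = 0" "\<exists>y. has_L2_derivative f y"
        and "ac_representative x f1" "f1 1 = 0"
        unfolding range_volterra_iff range_volterra_adj_iff by blast
      moreover from this have "f 1 = 0"
        using ac_representative_unique[of x f f1 1] by simp
      ultimately show "x \<in> {x. \<exists>f. ac_representative x f \<and> f 0 = 0 \<and> f 1 = 0 \<and> (\<exists>y. has_L2_derivative f y)}"
        by blast
    qed (unfold D_def dom dom' Int_iff range_volterra_iff range_volterra_adj_iff, blast)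
    show "subspace D"
      unfolding D by (intro linear_subspace_image linear_volterra)
        (simp add: subspace_def inner_add_right)
    show "closure D = UNIV"
      unfolding D by (rule volterra_image_dense)
    show "skew_op_on D T"
      unfolding skew_op_on_def
    proof (intro conjI ballI)
      show "subspace D" by fact
      show "D \<subseteq> op_dom T" by (auto simp: D_def)
      fix x y assume "x \<in> D" "y \<in> T x"
      then have "x = volterra y" "inner const1 y = 0"
        using injD[OF inj_volterra] by (auto simp: D T)
      then show "inner y x = 0"
        using inner_volterra_self[of y] by (simp add: inner_commute)
    qed
    show "skew_op_on D (op_adjoint T)"
      unfolding skew_op_on_def
    proof (intro conjI ballI)
      show "subspace D" by fact
      show "D \<subseteq> op_dom (op_adjoint T)" by (auto simp: D_def)
      fix x y assume "x \<in> D" "y \<in> op_adjoint T x"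
      from \<open>x \<in> D\<close> obtain z where z: "x = volterra z"
        unfolding D by blast
      with \<open>y \<in> op_adjoint T x\<close> have "volterra z = volterra_adj y"
        unfolding T' by simp
      then have "inner const1 z = 0" "y = - z"
        unfolding volterra_eq_volterra_adj_iff by simp_all
      then show "inner y x = 0"
        using inner_volterra_self[of z] by (simp add: z inner_commute)
    qed
  qed
qed

end
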